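(* Let $\beta>1$, $L>0$ and $f\in H(\beta,L)$. Let $(\theta_i,s_i)$, $i=1,2,\dots$, be i.i.d. random variables uniformly distributed on $Z=\mathrm{S}^1\times[-1,1]$, independent of the errors $\epsilon_i$, and let $Y_i=T_\mu f(\theta_i,s_i)+\epsilon_i$. Let $\rho_n>0$ be a sequence with $0<|\mu|<1/\rho_n$ for all $n$ and $\rho_n\to 0$ as $n\to\infty$. Consider the kernel estimator $$f_n^*(x)=\frac1n\sum_{i=1}^n e^{-\mu x\cdot\theta_i^\perp}K_{\rho_n}(x\cdot\theta_i-s_i)\,Y_i .$$ Then for each $x\in B_1=\{x\in\mathbb{R}^2:\|x\|\le 1\}$ the bias $B_n(x)=E_f(f_n^*(x))-f(x)$ tends to $0$ as $n\to\infty$.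
   Context: Function class: for $\beta>1$ and $L>0$, $H(\beta,L)$ is the class of functions $f:\mathbb{R}^2\to\mathbb{R}$ supported in the closed unit ball $B_1$ whose Fourier transform $\widetilde f(\xi)=\int_{\mathbb{R}^2}f(x)e^{-i\xi\cdot x}dx$ satisfies $\int_{\mathbb{R}^2}(1+\|\xi\|^2)^\beta|\widetilde f(\xi)|^2d\xi\le L$; since $\beta>1$, $f$ is taken to be its continuous representative. Exponential Radon transform: $\mu\in\mathbb{R}$ is a fixed constant (here $\mu\ne0$). For $\theta\in\mathrm{S}^1$ (the unit circle in $\mathbb{R}^2$), $\theta^\perp$ is the unit vector perpendicular to $\theta$ obtained by rotating $\theta$ by $\pi/2$ (a fixed orientation). For $(\theta,s)\in Z=\mathrm{S}^1\times[-1,1]$, $$T_\mu f(\theta,s)=\int_{x\cdot\theta=s}e^{\mu x\cdot\theta^\perp}f(x)\,dx,$$ with $dx$ arc length on the line $\{x: x\cdot\theta=s\}$. Kernel: for $\rho>0$ with $0<|\mu|<1/\rho$, $$K_\rho(s)=\frac1\pi\int_{|\mu|}^{\sqrt{(1/\rho^2)+\mu^2}}r\cos(sr)\,dr .$$ Errors: $\epsilon_i$ are i.i.d. real random variables with mean $0$ and finite variance $\sigma^2>0$. $E_f$ denotes expectation with respect to the joint distribution of $(\theta_i,s_i,Y_i)$, $i=1,\dots,n$, when the true function is $f$. *)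

theory Defs
  imports "HOL-Probability.Probability"
begin

definition fourier2 :: "(real^2 \<Rightarrow> real) \<Rightarrow> real^2 \<Rightarrow> complex" where
  "fourier2 f \<xi> = (\<integral>x. exp (- \<i> * complex_of_real (\<xi> \<bullet> x)) * complex_of_real (f x) \<partial>lborel)"

text \<open>Members are the continuous representatives themselves. The Sobolev bound is a nonnegative
  integral, so that it includes the finiteness of the integral.\<close>

definition sobolev_class :: "real \<Rightarrow> real \<Rightarrow> (real^2 \<Rightarrow> real) set" where
  "sobolev_class \<beta> L = {f. continuous_on UNIV f \<and> (\<forall>x. x \<notin> cball 0 1 \<longrightarrow> f x = 0) \<and>
     (\<integral>\<^sup>+\<xi>. ennreal ((1 + (norm \<xi>)\<^sup>2) powr \<beta> * (cmod (fourier2 f \<xi>))\<^sup>2) \<partial>lborel) \<le> ennreal L}"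

definition perp :: "real^2 \<Rightarrow> real^2" where
  "perp \<theta> = vector [- (\<theta> $ 2), \<theta> $ 1]"

text \<open>For a unit vector \<open>\<theta>\<close>, the map \<open>t \<mapsto> s \<theta> + t \<theta>\<^sup>\<bottom>\<close> is an isometric
  parametrisation of the line \<open>x \<bullet> \<theta> = s\<close>, so its image of Lebesgue measure is arc length.\<close>

definition line_measure :: "real^2 \<Rightarrow> real \<Rightarrow> (real^2) measure" where
  "line_measure \<theta> s = distr lborel borel (\<lambda>t. s *\<^sub>R \<theta> + t *\<^sub>R perp \<theta>)"

definition exp_radon :: "real \<Rightarrow> (real^2 \<Rightarrow> real) \<Rightarrow> real^2 \<Rightarrow> real \<Rightarrow> real" where
  "exp_radon \<mu> f \<theta> s = (\<integral>x. exp (\<mu> * (x \<bullet> perp \<theta>)) * f x \<partial>line_measure \<theta> s)"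

definition radon_kernel :: "real \<Rightarrow> real \<Rightarrow> real \<Rightarrow> real" where
  "radon_kernel \<mu> \<rho> s =
     1 / pi * (LINT r:{\<bar>\<mu>\<bar>..sqrt (1 / \<rho>\<^sup>2 + \<mu>\<^sup>2)}|lborel. r * cos (s * r))"

text \<open>Arc length on the unit circle.\<close>

definition circle_measure :: "(real^2) measure" where
  "circle_measure =
     distr (restrict_space lborel {0..<2 * pi}) borel (\<lambda>\<phi>. vector [cos \<phi>, sin \<phi>])"

definition uniform_Z :: "((real^2) \<times> real) measure" where
  "uniform_Z = uniform_measure (circle_measure \<Otimes>\<^sub>M lborel) (sphere 0 1 \<times> {-1..1})"

text \<open>The library's \<open>indep_var\<close> requires both random variables to have the same value type;
  this is its characterisation by generated \<open>\<sigma>\<close>-algebras, for arbitrary value types.\<close>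

definition indep_rv ::
  "'w measure \<Rightarrow> 'a measure \<Rightarrow> ('w \<Rightarrow> 'a) \<Rightarrow> 'b measure \<Rightarrow> ('w \<Rightarrow> 'b) \<Rightarrow> bool" where
  "indep_rv M N X N' X' \<longleftrightarrow> X \<in> measurable M N \<and> X' \<in> measurable M N' \<and>
     prob_space.indep_set M {X -` A \<inter> space M | A. A \<in> sets N}
       {X' -` B \<inter> space M | B. B \<in> sets N'}"

definition estimator ::
  "real \<Rightarrow> real \<Rightarrow> nat \<Rightarrow> (nat \<Rightarrow> real^2) \<Rightarrow> (nat \<Rightarrow> real) \<Rightarrow> (nat \<Rightarrow> real) \<Rightarrow> real^2 \<Rightarrow> real" where
  "estimator \<mu> \<rho> n \<theta> s Y x =
     1 / real n * (\<Sum>i=1..n. exp (- \<mu> * (x \<bullet> perp (\<theta> i))) * radon_kernel \<mu> \<rho> (x \<bullet> \<theta> i - s i) * Y i)"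

end

theory Submission
  imports Defs "HOL-Complex_Analysis.Cauchy_Integral_Theorem"
begin

unbundle no fps_syntax

text \<open>
  Averaging \<open>exp (- \<mu> z \<bullet> \<theta>\<^sup>\<bottom>) cos (r z \<bullet> \<theta>)\<close> over the unit circle amounts to averaging
  \<open>cos (u z \<bullet> \<theta>)\<close> with \<open>u\<^sup>2 = r\<^sup>2 - \<mu>\<^sup>2\<close>: the first integrand is the real part of the second one
  continued to complex angles and shifted along the imaginary axis. With the substitution
  \<open>r dr = u du\<close> and polar coordinates, the expected value of the estimator therefore becomes
  \<open>(2\<pi>)\<^sup>-\<^sup>2\<close> times the integral over \<open>\<parallel>\<xi>\<parallel> < 1 / \<rho>\<^sub>n\<close> of the real part of \<open>exp (i \<xi> \<bullet> x) f~(\<xi>)\<close>. The Sobolev bound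
  with \<open>\<beta> > 1\<close> makes the Fourier transform integrable, so that this truncated inversion
  integral converges to \<open>f x\<close>; the errors drop out by independence.
\<close>

section \<open>Lebesgue measure on the plane\<close>

text \<open>For one fixed direction \<theta>, the weight
  \<open>exp (- \<mu> * (x \<bullet> perp \<theta>))\<close> of the estimator and the weight
  \<open>exp (\<mu> * (y \<bullet> perp \<theta>))\<close> inside the transform combine into a
  function of \<open>x - y\<close> alone. The offset s and the position t on the line are
  orthonormal coordinates of the plane, so the mean is a convolution of \<open>f\<close> with the
  kernel averaged over the circle. The exponential cannot be removed direction by direction; it
  disappears only in that average. The limits of the kernel are made for this: with
  \<open>r = sqrt (u\<^sup>2 + \<mu>\<^sup>2)\<close> the lower limit is u = 0 and the upper one u =
  1 / \<rho>, so the frequencies fill a whole disc instead of an annulus. The constant of Fourier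
  inversion arises as the product of the density 1 / (4 pi) of the design and the factor 1 / pi of
  the kernel.\<close>

lemma vector_2_eq: "(vector [a, b] :: real^2) = a *\<^sub>R axis 1 1 + b *\<^sub>R axis 2 1"
  by (simp add: vec_eq_iff forall_2 axis_def)

lemma inner_real2: "(x::real^2) \<bullet> y = x $ 1 * y $ 1 + x $ 2 * y $ 2"
  by (simp add: inner_vec_def sum_2)

lemma norm_real2_sq: "(norm (x::real^2))\<^sup>2 = (x $ 1)\<^sup>2 + (x $ 2)\<^sup>2"
  by (simp only: power2_norm_eq_inner) (simp add: inner_real2 power2_eq_square)

lemma Basis_real2: "(Basis :: (real^2) set) = {axis 1 1, axis 2 1}"
  by (auto simp: Basis_vec_def UNIV_2)

lemma prod_Basis_real2: "(\<Prod>b\<in>Basis. h (b::real^2)) = h (axis 1 1) * h (axis 2 1)"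
  by (simp add: Basis_real2 axis_eq_axis)

lemma measurable_vector_2 [measurable]:
  "(\<lambda>p. vector [fst p, snd p] :: real^2) \<in> lborel \<Otimes>\<^sub>M lborel \<rightarrow>\<^sub>M borel"
  unfolding vector_2_eq by measurable

text \<open>Lebesgue measure is determined by its values on boxes, and a box in the plane is a
  product of intervals. This carries Fubini from \<open>lborel \<Otimes>\<^sub>M lborel\<close> over
  to \<open>real^2\<close>.\<close>

lemma lborel_real2_eq_distr:
  "distr (lborel \<Otimes>\<^sub>M lborel) borel (\<lambda>p. vector [fst p, snd p]) = (lborel :: (real^2) measure)"
proof (rule lborel_eqI[symmetric])
  fix l u :: "real^2" assume lu: "\<And>b. b \<in> Basis \<Longrightarrow> l \<bullet> b \<le> u \<bullet> b"
  have le: "l $ 1 \<le> u $ 1" "l $ 2 \<le> u $ 2"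
    using lu[of "axis 1 1"] lu[of "axis 2 1"] by (simp_all add: Basis_real2 inner_axis)
  have "(\<lambda>p. vector [fst p, snd p] :: real^2) -` box l u \<inter> space (lborel \<Otimes>\<^sub>M lborel)
      = {l $ 1<..<u $ 1} \<times> {l $ 2<..<u $ 2}"
    by (auto simp: box_def Basis_real2 inner_axis space_pair_measure)
  then have "emeasure (distr (lborel \<Otimes>\<^sub>M lborel) borel (\<lambda>p. vector [fst p, snd p])) (box l u)
     = emeasure (lborel \<Otimes>\<^sub>M lborel) ({l $ 1<..<u $ 1} \<times> {l $ 2<..<u $ 2})"
    by (subst emeasure_distr) auto
  also have "\<dots> = ennreal (u $ 1 - l $ 1) * ennreal (u $ 2 - l $ 2)"
    using le by (subst lborel.emeasure_pair_measure_Times) auto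
  also have "\<dots> = ennreal (prod ((\<bullet>) (u - l)) Basis)"
    using le by (simp add: prod_Basis_real2 inner_axis ennreal_mult')
  finally show "emeasure (distr (lborel \<Otimes>\<^sub>M lborel) borel (\<lambda>p. vector [fst p, snd p])) (box l u)
     = ennreal (prod ((\<bullet>) (u - l)) Basis)" .
qed simp

text \<open>It is enough to compare boxes. The preimage of a box is its image under the inverse map,
  which is again orthogonal and therefore preserves its Lebesgue measure.\<close>

lemma lborel_distr_orthogonal_transformation:
  fixes h :: "real^'n::{finite,wellorder} \<Rightarrow> real^'n::_"
  assumes h: "orthogonal_transformation h"
  shows "distr lborel borel h = lborel"
proof (rule lborel_eqI[symmetric])
  have lin: "linear h" using h by (rule orthogonal_transformation_linear)
  then have hm[measurable]: "h \<in> borel_measurable borel"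
    by (intro borel_measurable_continuous_onI linear_continuous_on linear_linear[THEN iffD2])
  fix l u :: "real^'n::_" assume lu: "\<And>b. b \<in> Basis \<Longrightarrow> l \<bullet> b \<le> u \<bullet> b"
  have bij: "bij h" using h by (rule orthogonal_transformation_bij)
  have eq: "h -` box l u = inv h ` box l u"
    using bij by (simp add: bij_vimage_eq_inv_image)
  have oi: "orthogonal_transformation (inv h)"
    using h by (rule orthogonal_transformation_inv)
  have m: "box l u \<in> lmeasurable" by simp
  have b: "h -` box l u \<in> sets borel"
    using measurable_sets[OF hm, of "box l u"] by simp
  have lm: "h -` box l u \<in> lmeasurable"
    unfolding eq by (rule measurable_orthogonal_image[OF oi m])
  have "emeasure (distr lborel borel h) (box l u) = emeasure lborel (h -` box l u)"
    by (subst emeasure_distr) auto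
  also have "\<dots> = emeasure lebesgue (h -` box l u)" using b by simp
  also have "\<dots> = measure lebesgue (h -` box l u)"
    using lm by (simp add: emeasure_eq_measure2 fmeasurableD2)
  also have "measure lebesgue (h -` box l u) = measure lebesgue (box l u)"
    unfolding eq by (rule measure_orthogonal_image[OF oi m])
  also have "\<dots> = (\<Prod>b\<in>Basis. (u - l) \<bullet> b)"
    using lu by (simp add: measure_lborel_box_eq)
  finally show "emeasure (distr lborel borel h) (box l u) = ennreal (prod ((\<bullet>) (u - l)) Basis)" .
qed simp

lemma perp_nth [simp]: "perp \<theta> $ 1 = - (\<theta> $ 2)" "perp \<theta> $ 2 = \<theta> $ 1"
  by (simp_all add: perp_def)

lemma orthogonal_transformation_frame:
  assumes "norm \<theta> = 1"
  shows "orthogonal_transformation (\<lambda>x::real^2. x $ 1 *\<^sub>R \<theta> + x $ 2 *\<^sub>R perp \<theta>)"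
  unfolding orthogonal_transformation_def
proof (intro conjI allI)
  show "linear (\<lambda>x::real^2. x $ 1 *\<^sub>R \<theta> + x $ 2 *\<^sub>R perp \<theta>)"
    by (rule linearI) (auto simp: algebra_simps)
  have n: "\<theta> $ 1 * \<theta> $ 1 + \<theta> $ 2 * \<theta> $ 2 = 1"
    using assms by (simp add: norm_eq_1 inner_real2)
  fix v w :: "real^2"
  have "(v $ 1 *\<^sub>R \<theta> + v $ 2 *\<^sub>R perp \<theta>) \<bullet> (w $ 1 *\<^sub>R \<theta> + w $ 2 *\<^sub>R perp \<theta>)
     = (v \<bullet> w) * (\<theta> $ 1 * \<theta> $ 1 + \<theta> $ 2 * \<theta> $ 2)"
    by (simp add: inner_real2 algebra_simps)
  then show "(v $ 1 *\<^sub>R \<theta> + v $ 2 *\<^sub>R perp \<theta>) \<bullet> (w $ 1 *\<^sub>R \<theta> + w $ 2 *\<^sub>R perp \<theta>) = v \<bullet> w"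
    using n by simp
qed

text \<open>A rotation of the coordinate version. It slices the plane into the lines orthogonal to
  \<theta>, so that an integral over offsets of line integrals becomes a plane integral.\<close>

lemma lborel_real2_eq_distr_frame:
  assumes "norm \<theta> = 1"
  shows "distr (lborel \<Otimes>\<^sub>M lborel) borel (\<lambda>p. fst p *\<^sub>R \<theta> + snd p *\<^sub>R perp \<theta>) = lborel"
proof -
  have "lborel = distr (distr (lborel \<Otimes>\<^sub>M lborel) borel (\<lambda>p. vector [fst p, snd p])) borel
      (\<lambda>x::real^2. x $ 1 *\<^sub>R \<theta> + x $ 2 *\<^sub>R perp \<theta>)"
    unfolding lborel_real2_eq_distr
    by (rule lborel_distr_orthogonal_transformation[OF orthogonal_transformation_frame[OF assms], symmetric])
  also have "\<dots> = distr (lborel \<Otimes>\<^sub>M lborel) borel (\<lambda>p. fst p *\<^sub>R \<theta> + snd p *\<^sub>R perp \<theta>)"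
    by (subst distr_distr) (auto simp: comp_def)
  finally show ?thesis by simp
qed


section \<open>Fourier inversion in the plane\<close>

lemma (in pair_sigma_finite) integrable_times:
  fixes p :: "'a \<Rightarrow> 'c :: {real_normed_field, banach, second_countable_topology}"
  assumes p: "integrable M1 p" and q: "integrable M2 q"
  shows "integrable (M1 \<Otimes>\<^sub>M M2) (\<lambda>(a, b). p a * q b)"
proof (rule Fubini_integrable)
  have [measurable]: "p \<in> borel_measurable M1" "q \<in> borel_measurable M2" using p q by auto
  show "(\<lambda>(a, b). p a * q b) \<in> borel_measurable (M1 \<Otimes>\<^sub>M M2)" by measurable
  show "integrable M1 (\<lambda>x. \<integral>y. norm (case (x, y) of (a, b) \<Rightarrow> p a * q b) \<partial>M2)"
    using p by (simp add: norm_mult)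
  show "AE x in M1. integrable M2 (\<lambda>y. case (x, y) of (a, b) \<Rightarrow> p a * q b)"
    using q by simp
qed

lemma (in pair_sigma_finite) integral_times:
  fixes p :: "'a \<Rightarrow> 'c :: {real_normed_field, banach, second_countable_topology}"
  assumes p: "integrable M1 p" and q: "integrable M2 q"
  shows "(\<integral>(a, b). p a * q b \<partial>(M1 \<Otimes>\<^sub>M M2)) = (\<integral>a. p a \<partial>M1) * (\<integral>b. q b \<partial>M2)"
  using integral_fst'[OF integrable_times[OF p q]] by simp

lemma integrable_real2_times:
  fixes p q :: "real \<Rightarrow> 'c :: {real_normed_field, banach, second_countable_topology}"
  assumes p: "integrable lborel p" and q: "integrable lborel q"
  shows "integrable lborel (\<lambda>x::real^2. p (x $ 1) * q (x $ 2))"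
proof -
  have [measurable]: "p \<in> borel_measurable borel" "q \<in> borel_measurable borel" using p q by auto
  show ?thesis
    using lborel_pair.integrable_times[OF p q]
    by (subst lborel_real2_eq_distr[symmetric], subst integrable_distr_eq)
       (auto simp: case_prod_unfold)
qed

lemma integral_real2_times:
  fixes p q :: "real \<Rightarrow> 'c :: {real_normed_field, banach, second_countable_topology}"
  assumes p: "integrable lborel p" and q: "integrable lborel q"
  shows "(\<integral>x. p (x $ 1) * q (x $ 2) \<partial>(lborel :: (real^2) measure)) = (\<integral>a. p a \<partial>lborel) * (\<integral>b. q b \<partial>lborel)"
proof -
  have [measurable]: "p \<in> borel_measurable borel" "q \<in> borel_measurable borel" using p q by auto
  show ?thesis
    using lborel_pair.integral_times[OF p q]
    by (subst lborel_real2_eq_distr[symmetric], subst integral_distr)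
       (auto simp: case_prod_unfold)
qed

text \<open>The sign of \<open>c\<close> is free: Fourier inversion uses a positive dilation on the
  frequency side and the reflection y = x - e w on the side of \<open>f\<close>.\<close>

lemma lborel_integral_affine:
  fixes h :: "'a::euclidean_space \<Rightarrow> 'b::{banach, second_countable_topology}"
  assumes [measurable]: "h \<in> borel_measurable borel" and "c \<noteq> 0"
  shows "(\<integral>x. h x \<partial>lborel) = \<bar>c\<bar> ^ DIM('a) *\<^sub>R (\<integral>x. h (t + c *\<^sub>R x) \<partial>lborel)"
proof -
  have "(lborel :: 'a measure) = density (distr lborel borel (\<lambda>x. t + c *\<^sub>R x)) (\<lambda>_. ennreal (\<bar>c\<bar>^DIM('a)))"
    using lborel_affine[OF assms(2), of t] by (simp add: ennreal_power)
  then have "(\<integral>x. h x \<partial>lborel) = (\<integral>x. h x \<partial>density (distr lborel borel (\<lambda>x. t + c *\<^sub>R x)) (\<lambda>_. ennreal (\<bar>c\<bar>^DIM('a))))"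
    by simp
  then show ?thesis
    by (simp add: integral_density integral_distr)
qed

section \<open>The Gaussian on the plane and its Fourier transform\<close>

definition gauss2 :: "real^2 \<Rightarrow> real" where
  "gauss2 w = std_normal_density (w $ 1) * std_normal_density (w $ 2)"

lemma gauss2_eq: "gauss2 w = exp (- (norm w)\<^sup>2 / 2) / (2 * pi)"
proof -
  show ?thesis
    by (simp add: norm_real2_sq gauss2_def std_normal_density_def exp_add[symmetric] add_divide_distrib)
qed

lemma gauss2_nonneg: "gauss2 w \<ge> 0"
  by (simp add: gauss2_eq)

lemma integrable_gauss2: "integrable lborel gauss2"
  unfolding gauss2_def by (intro integrable_real2_times) auto

lemma measurable_gauss2 [measurable]: "gauss2 \<in> borel_measurable borel"
  using integrable_gauss2 by auto

lemma integral_gauss2: "(\<integral>w. gauss2 w \<partial>lborel) = 1"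
  unfolding gauss2_def by (subst integral_real2_times) auto

lemma std_normal_fourier:
  "(\<integral>a. complex_of_real (std_normal_density a) * iexp (t * a) \<partial>lborel) = of_real (exp (- t\<^sup>2 / 2))"
proof -
  have "char std_normal_distribution t = (\<integral>a. std_normal_density a *\<^sub>R iexp (t * a) \<partial>lborel)"
    unfolding char_def by (subst integral_density) auto
  then show ?thesis
    by (simp add: char_std_normal_distribution scaleR_conv_of_real)
qed

text \<open>The cosine is the real part of a product of two exponentials, one for each coordinate,
  so the integral splits into two characteristic functions of the standard normal law. The factor
  \<open>2 * pi\<close> undoes the normalisation of \<open>gauss2\<close>.\<close>

lemma integral_gauss2_cos:
  "(\<integral>w. gauss2 w * cos (w \<bullet> v) \<partial>lborel) = 2 * pi * gauss2 v"
proof -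
  have i: "integrable lborel (\<lambda>a. complex_of_real (std_normal_density a) * iexp (t * a))" for t
  proof (rule Bochner_Integration.integrable_bound)
    show "integrable lborel std_normal_density" by simp
    show "(\<lambda>a. complex_of_real (std_normal_density a) * iexp (t * a)) \<in> borel_measurable lborel"
      by (intro borel_measurable_times borel_measurable_of_real borel_measurable_continuous_onI continuous_intros)
         (auto simp: measurable_lborel1)
  qed (simp add: norm_mult)
  have "(\<lambda>w. gauss2 w * cos (w \<bullet> v)) = (\<lambda>w::real^2. Re ((complex_of_real (std_normal_density (w $ 1)) * iexp (v $ 1 * w $ 1))
      * (complex_of_real (std_normal_density (w $ 2)) * iexp (v $ 2 * w $ 2))))"
    by (rule ext) (simp add: gauss2_def Re_exp Im_exp inner_real2 cos_add algebra_simps)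
  then have "(\<integral>w. gauss2 w * cos (w \<bullet> v) \<partial>lborel) = Re (\<integral>w. (complex_of_real (std_normal_density (w $ 1)) * iexp (v $ 1 * w $ 1))
      * (complex_of_real (std_normal_density (w $ 2)) * iexp (v $ 2 * w $ 2)) \<partial>(lborel :: (real^2) measure))"
    by (simp only: integral_Re[OF integrable_real2_times[OF i i]])
  also have "\<dots> = exp (- (v $ 1)\<^sup>2 / 2) * exp (- (v $ 2)\<^sup>2 / 2)"
    by (simp only: integral_real2_times[OF i i] std_normal_fourier of_real_mult[symmetric] Re_complex_of_real)
  also have "\<dots> = 2 * pi * gauss2 v"
    by (simp add: gauss2_def std_normal_density_def exp_add[symmetric])
  finally show ?thesis .
qed

section \<open>Integrability of the Fourier transform under the Sobolev bound\<close>

lemma integrable_one_plus_square_powr: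
  assumes "\<beta> > (1::real)"
  shows "integrable lborel (\<lambda>a::real. (1 + a\<^sup>2) powr (- \<beta> / 2))"
proof -
  define h where "h a = indicator {1..} a * a powr (- \<beta>)" for a :: real
  have "(\<lambda>a. a powr (- \<beta>)) integrable_on {1..}"
    using has_integral_powr_to_inf[of "- \<beta>" 1] assms by (auto simp: integrable_on_def)
  then have "(\<lambda>a. a powr (- \<beta>)) absolutely_integrable_on {1..}"
    by (intro nonnegative_absolutely_integrable_1) auto
  then have h: "integrable lborel h"
    unfolding h_def set_integrable_def
    by (subst (asm) integrable_completion) auto
  then have h': "integrable lborel (\<lambda>a. h (0 + (-1) * a))"
    by (rule lborel_integrable_real_affine) simp
  \<comment> \<open>The majorant is 1 on the central interval and
    \<open>\<bar>a\<bar> powr (- \<beta>)\<close> on both tails; \<open>h\<close> is the right tail,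
    and its reflection is the left one.\<close>
  have "integrable lborel (\<lambda>a. indicator {-1..1} a + h a + h (0 + (-1) * a))"
    using h h' by (intro Bochner_Integration.integrable_add) auto
  then show ?thesis
  proof (rule Bochner_Integration.integrable_bound)
    have "(1 + a\<^sup>2) powr (- \<beta> / 2) \<le> indicator {-1..1} a + h a + h (- a)" for a :: real
    proof (cases "\<bar>a\<bar> \<le> 1")
      case True
      have "(1 + a\<^sup>2) powr (- \<beta> / 2) \<le> 1 powr (- \<beta> / 2)"
        using assms by (intro powr_mono2') auto
      also have "\<dots> = indicator {-1..1} a" using True by (simp add: abs_le_iff)
      finally show ?thesis by (simp add: h_def add_increasing2)
    next
      case False
      have "(1 + a\<^sup>2) powr (- \<beta> / 2) \<le> (\<bar>a\<bar>\<^sup>2) powr (- \<beta> / 2)"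
        using assms False by (intro powr_mono2') auto
      also have "\<bar>a\<bar>\<^sup>2 = \<bar>a\<bar> powr 2"
        using False by simp
      also have "(\<bar>a\<bar> powr 2) powr (- \<beta> / 2) = \<bar>a\<bar> powr (- \<beta>)"
        by (simp add: powr_powr del: powr_numeral)
      also have "\<dots> \<le> indicator {-1..1} a + h a + h (- a)"
        using False by (auto simp: h_def indicator_def abs_if)
      finally show ?thesis .
    qed
    from order.trans[OF this abs_ge_self]
    show "AE a in lborel. norm ((1 + a\<^sup>2) powr (- \<beta> / 2)) \<le> norm (indicator {-1..1} a + h a + h (0 + (-1) * a))"
      by simp
  qed measurable
qed

text \<open>Half of the exponent is spent on each coordinate, since the squared norm is at least the
  square of either one. Each half is integrable on the line exactly under the one-dimensional
  condition \<beta> > 1.\<close>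

lemma integrable_one_plus_norm_square_powr:
  assumes "\<beta> > (1::real)"
  shows "integrable lborel (\<lambda>\<xi>::real^2. (1 + (norm \<xi>)\<^sup>2) powr (- \<beta>))"
proof (rule Bochner_Integration.integrable_bound)
  let ?p = "\<lambda>a::real. (1 + a\<^sup>2) powr (- \<beta> / 2)"
  show "integrable lborel (\<lambda>\<xi>::real^2. ?p (\<xi> $ 1) * ?p (\<xi> $ 2))"
    using integrable_one_plus_square_powr[OF assms] by (intro integrable_real2_times)
  have "(1 + (norm \<xi>)\<^sup>2) powr (- \<beta>) \<le> ?p (\<xi> $ 1) * ?p (\<xi> $ 2)" for \<xi> :: "real^2"
  proof -
    have n: "(norm \<xi>)\<^sup>2 = (\<xi> $ 1)\<^sup>2 + (\<xi> $ 2)\<^sup>2"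
      by (rule norm_real2_sq)
    have pos: "0 < (1 + (norm \<xi>)\<^sup>2)" by (simp add: add_pos_nonneg)
    have "(1 + (norm \<xi>)\<^sup>2) powr (- \<beta>) = (1 + (norm \<xi>)\<^sup>2) powr (- \<beta> / 2) * (1 + (norm \<xi>)\<^sup>2) powr (- \<beta> / 2)"
      by (simp add: powr_add[symmetric])
    also have "\<dots> \<le> ?p (\<xi> $ 1) * ?p (\<xi> $ 2)"
      using assms n by (intro mult_mono powr_mono2') (auto simp: add_pos_nonneg)
    finally show ?thesis .
  qed
  then show "AE \<xi> in lborel. norm ((1 + (norm \<xi>)\<^sup>2) powr (- \<beta>)) \<le> norm (?p ((\<xi>::real^2) $ 1) * ?p (\<xi> $ 2))"
    by (intro AE_I2) simp
qed measurable

text \<open>The real part of \<open>exp (i \<xi> \<bullet> x)\<close> times the Fourier transform of \<open>f\<close> at \<open>\<xi>\<close>.\<close>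

definition cos_transform :: "(real^2 \<Rightarrow> real) \<Rightarrow> real^2 \<Rightarrow> real^2 \<Rightarrow> real" where
  "cos_transform f x \<xi> = (\<integral>y. f y * cos (\<xi> \<bullet> (x - y)) \<partial>lborel)"

lemma measurable_cos_transform [measurable]:
  assumes [measurable]: "f \<in> borel_measurable borel"
  shows "cos_transform f x \<in> borel_measurable borel"
  unfolding cos_transform_def by measurable

lemma measurable_fourier2 [measurable]:
  assumes [measurable]: "f \<in> borel_measurable borel"
  shows "fourier2 f \<in> borel_measurable borel"
proof -
  have [measurable]: "(exp :: complex \<Rightarrow> complex) \<in> borel_measurable borel"
    by (intro borel_measurable_continuous_onI continuous_intros)
  show ?thesis unfolding fourier2_def by measurable
qed

lemma cos_transform_le_fourier2:
  assumes f: "integrable lborel f"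
  shows "\<bar>cos_transform f x \<xi>\<bar> \<le> cmod (fourier2 f \<xi>)"
proof -
  have [measurable]: "f \<in> borel_measurable borel" using f by auto
  have [measurable]: "(exp :: complex \<Rightarrow> complex) \<in> borel_measurable borel"
    by (intro borel_measurable_continuous_onI continuous_intros)
  have i: "integrable lborel (\<lambda>y. iexp (\<xi> \<bullet> x) * (exp (- \<i> * complex_of_real (\<xi> \<bullet> y)) * complex_of_real (f y)))"
    by (rule Bochner_Integration.integrable_bound[OF f]) (auto simp: norm_mult)
  have "cos_transform f x \<xi> = (\<integral>y. Re (iexp (\<xi> \<bullet> x) * (exp (- \<i> * complex_of_real (\<xi> \<bullet> y)) * complex_of_real (f y))) \<partial>lborel)"
  proof -
    have "iexp (\<xi> \<bullet> x) * (exp (- \<i> * complex_of_real (\<xi> \<bullet> y)) * complex_of_real (f y))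
      = complex_of_real (f y) * iexp (\<xi> \<bullet> (x - y))" for y
      by (simp add: inner_diff_right right_diff_distrib exp_diff exp_minus divide_inverse)
    then show ?thesis
      unfolding cos_transform_def by (simp only:) (simp add: Re_exp)
  qed
  also have "\<dots> = Re (iexp (\<xi> \<bullet> x) * fourier2 f \<xi>)"
    using integral_Re[OF i] by (simp add: fourier2_def)
  finally show ?thesis
    using abs_Re_le_cmod[of "iexp (\<xi> \<bullet> x) * fourier2 f \<xi>"] by (simp add: norm_mult)
qed

lemma sobolev_class_integrable_fourier2:
  assumes f: "f \<in> sobolev_class \<beta> L" and \<beta>: "\<beta> > 1" and [measurable]: "f \<in> borel_measurable borel"
  shows "integrable lborel (fourier2 f)"
proof -
  let ?w = "\<lambda>\<xi>. (1 + (norm \<xi>)\<^sup>2) powr \<beta> * (cmod (fourier2 f \<xi>))\<^sup>2"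
  have "(\<integral>\<^sup>+\<xi>. ennreal (?w \<xi>) \<partial>lborel) < \<infinity>"
    using f unfolding sobolev_class_def by (auto intro: le_less_trans)
  then have w: "integrable lborel ?w"
    by (intro integrableI_nonneg) auto
  have "integrable lborel (\<lambda>\<xi>. (1 + (norm \<xi>)\<^sup>2) powr (- \<beta>) + ?w \<xi>)"
    using w integrable_one_plus_norm_square_powr[OF \<beta>] by auto
  then show ?thesis
  proof (rule Bochner_Integration.integrable_bound)
    \<comment> \<open>\<open>t \<le> 1 / A + A t\<^sup>2\<close> for \<open>A > 0\<close>, in place of Cauchy--Schwarz\<close>
    have "cmod (fourier2 f \<xi>) \<le> (1 + (norm \<xi>)\<^sup>2) powr (- \<beta>) + ?w \<xi>" for \<xi>
    proof -
      define A t where "A = (1 + (norm \<xi>)\<^sup>2) powr \<beta>" and "t = cmod (fourier2 f \<xi>)"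
      have "1 + (norm \<xi>)\<^sup>2 > 0" by (simp add: add_pos_nonneg)
      then have A: "A > 0" by (simp add: A_def)
      have t: "t \<ge> 0" by (simp add: t_def)
      have "t \<le> inverse A + A * t\<^sup>2"
      proof (cases "A * t \<ge> 1")
        case True
        then have "1 * t \<le> (A * t) * t" using t by (intro mult_right_mono)
        then show ?thesis using A by (simp add: power2_eq_square mult.assoc add_increasing)
      next
        case False
        then have "t \<le> inverse A" using A by (simp add: field_simps)
        then show ?thesis using A by (simp add: add_increasing2)
      qed
      then show ?thesis by (simp add: A_def t_def powr_minus)
    qed
    from order.trans[OF this abs_ge_self]
    show "AE \<xi> in lborel. norm (fourier2 f \<xi>) \<le> norm ((1 + (norm \<xi>)\<^sup>2) powr (- \<beta>) + ?w \<xi>)"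
      by simp
  qed measurable
qed

section \<open>Gaussian regularisation and the inversion formula\<close>

lemma integral_gauss2_scaled_cos:
  assumes "e > 0"
  shows "(\<integral>\<xi>. gauss2 (e *\<^sub>R \<xi>) * cos (\<xi> \<bullet> v) \<partial>lborel) = 2 * pi / e\<^sup>2 * gauss2 (v /\<^sub>R e)"
proof -
  have "2 * pi * gauss2 (v /\<^sub>R e) = (\<integral>w. gauss2 w * cos (w \<bullet> (v /\<^sub>R e)) \<partial>lborel)"
    by (rule integral_gauss2_cos[symmetric])
  also have "\<dots> = e\<^sup>2 * (\<integral>\<xi>. gauss2 (0 + e *\<^sub>R \<xi>) * cos ((0 + e *\<^sub>R \<xi>) \<bullet> (v /\<^sub>R e)) \<partial>lborel)"
    using assms by (subst lborel_integral_affine[where c=e and t=0]) auto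
  also have "\<dots> = e\<^sup>2 * (\<integral>\<xi>. gauss2 (e *\<^sub>R \<xi>) * cos (\<xi> \<bullet> v) \<partial>lborel)"
    using assms by (simp add: mult.assoc[symmetric])
  finally show ?thesis using assms by (simp add: field_simps)
qed

lemma integrable_gauss2_scaled:
  assumes "e > 0"
  shows "integrable lborel (\<lambda>\<xi>. gauss2 (e *\<^sub>R \<xi>))"
proof (rule integrableI_bounded)
  have "(\<integral>\<^sup>+\<xi>. ennreal (gauss2 \<xi>) \<partial>lborel) = ennreal (e\<^sup>2) * (\<integral>\<^sup>+\<xi>. ennreal (gauss2 (e *\<^sub>R \<xi>)) \<partial>lborel)"
    using assms
    by (subst lborel_affine[where t=0 and c=e])
       (auto simp: nn_integral_density nn_integral_distr nn_integral_cmult ennreal_power)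
  moreover have "(\<integral>\<^sup>+\<xi>. ennreal (gauss2 \<xi>) \<partial>lborel) = 1"
    using integral_gauss2 integrable_gauss2 by (subst nn_integral_eq_integral) (auto simp: gauss2_nonneg)
  ultimately have "ennreal (e\<^sup>2) * (\<integral>\<^sup>+\<xi>. ennreal (gauss2 (e *\<^sub>R \<xi>)) \<partial>lborel) \<noteq> \<infinity>" by simp
  then show "(\<integral>\<^sup>+\<xi>. ennreal (norm (gauss2 (e *\<^sub>R \<xi>))) \<partial>lborel) < \<infinity>"
    using assms by (auto simp: gauss2_nonneg ennreal_mult_eq_top_iff less_top)
qed measurable


text \<open>Both sides are limits of the integral of the transform against a dilated Gaussian.\<close>

lemma fourier_inversion_real2:
  fixes f :: "real^2 \<Rightarrow> real"
  assumes cont: "continuous_on UNIV f" and f: "integrable lborel f"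
    and B: "\<And>y. \<bar>f y\<bar> \<le> B" and i: "integrable lborel (fourier2 f)"
  shows "integrable lborel (cos_transform f x)"
    and "(\<integral>\<xi>. cos_transform f x \<xi> \<partial>lborel) = (2 * pi)\<^sup>2 * f x"
proof -
  have fm[measurable]: "f \<in> borel_measurable borel" using cont by (rule borel_measurable_continuous_onI)
  show ci: "integrable lborel (cos_transform f x)"
    by (rule Bochner_Integration.integrable_bound[OF i]) (use cos_transform_le_fourier2[OF f] in auto)
  define e where "e k = 1 / real (Suc k)" for k
  have e0: "e k > 0" for k by (simp add: e_def)
  have elim: "e \<longlonglongrightarrow> 0" unfolding e_def by (rule LIMSEQ_Suc[OF lim_1_over_n])
  \<comment> \<open>The factor \<open>2 * pi\<close> turns the Gaussian into an exponential that is
    at most 1 and tends to 1 pointwise as the dilation shrinks, so the transform dominates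
    itself.\<close>
  have lim1: "(\<lambda>k. \<integral>\<xi>. cos_transform f x \<xi> * (2 * pi * gauss2 (e k *\<^sub>R \<xi>)) \<partial>lborel)
      \<longlonglongrightarrow> (\<integral>\<xi>. cos_transform f x \<xi> \<partial>lborel)"
  proof (rule integral_dominated_convergence[where w="\<lambda>\<xi>. \<bar>cos_transform f x \<xi>\<bar>"])
    have "(\<lambda>k. cos_transform f x \<xi> * (2 * pi * gauss2 (e k *\<^sub>R \<xi>))) \<longlonglongrightarrow> cos_transform f x \<xi>" for \<xi>
    proof -
      have "(\<lambda>k. cos_transform f x \<xi> * exp (- (norm (e k *\<^sub>R \<xi>))\<^sup>2 / 2)) \<longlonglongrightarrow> cos_transform f x \<xi> * exp (- (norm (0 *\<^sub>R \<xi>))\<^sup>2 / 2)"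
        by (intro tendsto_intros elim) simp
      then show ?thesis by (simp add: gauss2_eq)
    qed
    then show "AE \<xi> in lborel. (\<lambda>k. cos_transform f x \<xi> * (2 * pi * gauss2 (e k *\<^sub>R \<xi>))) \<longlonglongrightarrow> cos_transform f x \<xi>"
      by simp
    show "AE \<xi> in lborel. norm (cos_transform f x \<xi> * (2 * pi * gauss2 (e k *\<^sub>R \<xi>))) \<le> \<bar>cos_transform f x \<xi>\<bar>" for k
      using mult_left_le[of "exp (- (norm (e k *\<^sub>R \<xi>))\<^sup>2 / 2)" "\<bar>cos_transform f x \<xi>\<bar>" for \<xi>]
      by (simp add: gauss2_eq abs_mult)
  qed (use ci in auto)
  \<comment> \<open>Fubini moves the Gaussian onto \<open>f\<close>, where its transform is an
    approximate identity. In the variable w the width \<open>e k\<close> survives only in the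
    argument of \<open>f\<close>, because the Jacobian cancels the factor
    \<open>1 / (e k)\<^sup>2\<close> of the transformed Gaussian.\<close>
  have eq: "(\<integral>\<xi>. cos_transform f x \<xi> * (2 * pi * gauss2 (e k *\<^sub>R \<xi>)) \<partial>lborel)
      = (2 * pi)\<^sup>2 * (\<integral>w. f (x - e k *\<^sub>R w) * gauss2 w \<partial>lborel)" for k
  proof -
    \<comment> \<open>The Gaussian supplies the decay in \<xi> that the cosine lacks; this makes the
      double integral absolutely convergent.\<close>
    have int: "integrable (lborel \<Otimes>\<^sub>M lborel) (\<lambda>(\<xi>, y). gauss2 (e k *\<^sub>R \<xi>) * f y)"
      by (intro lborel_pair.integrable_times integrable_gauss2_scaled e0 f)
    have "norm (gauss2 (e k *\<^sub>R \<xi>) * f y * cos (\<xi> \<bullet> (x - y))) \<le> norm (gauss2 (e k *\<^sub>R \<xi>) * f y)" for \<xi> y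
      using mult_left_le[of "\<bar>cos (\<xi> \<bullet> (x - y))\<bar>" "\<bar>gauss2 (e k *\<^sub>R \<xi>) * f y\<bar>"] by (simp add: abs_mult)
    then have int2: "integrable (lborel \<Otimes>\<^sub>M lborel) (\<lambda>(\<xi>, y). gauss2 (e k *\<^sub>R \<xi>) * f y * cos (\<xi> \<bullet> (x - y)))"
      by (intro Bochner_Integration.integrable_bound[OF int] AE_I2) (measurable, auto)
    have "(\<integral>\<xi>. cos_transform f x \<xi> * (2 * pi * gauss2 (e k *\<^sub>R \<xi>)) \<partial>lborel)
       = 2 * pi * (\<integral>\<xi>. (\<integral>y. gauss2 (e k *\<^sub>R \<xi>) * f y * cos (\<xi> \<bullet> (x - y)) \<partial>lborel) \<partial>lborel)"
    proof -
      have "cos_transform f x \<xi> * (2 * pi * gauss2 (e k *\<^sub>R \<xi>))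
        = 2 * pi * (\<integral>y. gauss2 (e k *\<^sub>R \<xi>) * f y * cos (\<xi> \<bullet> (x - y)) \<partial>lborel)" for \<xi>
        unfolding cos_transform_def by (simp add: mult.assoc)
      then have "(\<integral>\<xi>. cos_transform f x \<xi> * (2 * pi * gauss2 (e k *\<^sub>R \<xi>)) \<partial>lborel)
         = (\<integral>\<xi>. 2 * pi * (\<integral>y. gauss2 (e k *\<^sub>R \<xi>) * f y * cos (\<xi> \<bullet> (x - y)) \<partial>lborel) \<partial>lborel)"
        by (simp only:)
      then show ?thesis by simp
    qed
    also have "\<dots> = 2 * pi * (\<integral>y. (\<integral>\<xi>. gauss2 (e k *\<^sub>R \<xi>) * f y * cos (\<xi> \<bullet> (x - y)) \<partial>lborel) \<partial>lborel)"
      by (rule arg_cong[OF lborel_pair.Fubini_integral[OF int2, symmetric]])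
    also have "\<dots> = 2 * pi * (\<integral>y. f y * (\<integral>\<xi>. gauss2 (e k *\<^sub>R \<xi>) * cos (\<xi> \<bullet> (x - y)) \<partial>lborel) \<partial>lborel)"
    proof -
      have "(\<integral>\<xi>. gauss2 (e k *\<^sub>R \<xi>) * f y * cos (\<xi> \<bullet> (x - y)) \<partial>lborel)
        = f y * (\<integral>\<xi>. gauss2 (e k *\<^sub>R \<xi>) * cos (\<xi> \<bullet> (x - y)) \<partial>lborel)" for y
        by (subst integral_mult_right_zero[symmetric]) (simp add: ac_simps)
      then show ?thesis by simp
    qed
    also have "\<dots> = 2 * pi * (\<integral>y. f y * (2 * pi / (e k)\<^sup>2 * gauss2 ((x - y) /\<^sub>R e k)) \<partial>lborel)"
      by (simp only: integral_gauss2_scaled_cos[OF e0])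
    also have "\<dots> = 2 * pi * ((e k)\<^sup>2 * (\<integral>w. f (x + (- e k) *\<^sub>R w) * (2 * pi / (e k)\<^sup>2 * gauss2 ((x - (x + (- e k) *\<^sub>R w)) /\<^sub>R e k)) \<partial>lborel))"
      using e0[of k] by (subst lborel_integral_affine[where c="- e k" and t=x]) auto
    also have "\<dots> = (2 * pi)\<^sup>2 * (\<integral>w. f (x - e k *\<^sub>R w) * gauss2 w \<partial>lborel)"
    proof -
      have "f (x + (- e k) *\<^sub>R w) * (2 * pi / (e k)\<^sup>2 * gauss2 ((x - (x + (- e k) *\<^sub>R w)) /\<^sub>R e k))
        = 2 * pi / (e k)\<^sup>2 * (f (x - e k *\<^sub>R w) * gauss2 w)" for w
        using e0[of k] by simp
      then have "2 * pi * ((e k)\<^sup>2 * (\<integral>w. f (x + (- e k) *\<^sub>R w) * (2 * pi / (e k)\<^sup>2 * gauss2 ((x - (x + (- e k) *\<^sub>R w)) /\<^sub>R e k)) \<partial>lborel))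
        = 2 * pi * ((e k)\<^sup>2 * (\<integral>w. 2 * pi / (e k)\<^sup>2 * (f (x - e k *\<^sub>R w) * gauss2 w) \<partial>lborel))"
        by (simp only:)
      then show ?thesis using e0[of k] by (simp add: power2_eq_square)
    qed
    finally show ?thesis .
  qed
  \<comment> \<open>Continuity gives the limit at the given point itself, and the bound
    \<open>B\<close> on \<open>f\<close> gives an integrable majorant.\<close>
  have "(\<lambda>k. \<integral>w. f (x - e k *\<^sub>R w) * gauss2 w \<partial>lborel) \<longlonglongrightarrow> (\<integral>w. f x * gauss2 w \<partial>lborel)"
  proof (rule integral_dominated_convergence[where w="\<lambda>w. B * gauss2 w"])
    have "(\<lambda>k. f (x - e k *\<^sub>R w) * gauss2 w) \<longlonglongrightarrow> f x * gauss2 w" for w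
    proof -
      have "(\<lambda>k. x - e k *\<^sub>R w) \<longlonglongrightarrow> x - 0 *\<^sub>R w" by (intro tendsto_intros elim)
      then have "(\<lambda>k. f (x - e k *\<^sub>R w)) \<longlonglongrightarrow> f x"
        using cont by (auto intro!: continuous_on_tendsto_compose[of UNIV f])
      then show ?thesis by (intro tendsto_intros)
    qed
    then show "AE w in lborel. (\<lambda>k. f (x - e k *\<^sub>R w) * gauss2 w) \<longlonglongrightarrow> f x * gauss2 w" by simp
    show "AE w in lborel. norm (f (x - e k *\<^sub>R w) * gauss2 w) \<le> B * gauss2 w" for k
      using B by (intro AE_I2) (auto simp: abs_mult gauss2_nonneg intro!: mult_right_mono)
  qed (use integrable_gauss2 in auto)
  then have "(\<lambda>k. (2 * pi)\<^sup>2 * (\<integral>w. f (x - e k *\<^sub>R w) * gauss2 w \<partial>lborel)) \<longlonglongrightarrow> (2 * pi)\<^sup>2 * f x"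
    by (intro tendsto_intros) (simp add: integral_gauss2)
  then show "(\<integral>\<xi>. cos_transform f x \<xi> \<partial>lborel) = (2 * pi)\<^sup>2 * f x"
    using lim1 unfolding eq by (rule LIMSEQ_unique[rotated])
qed


section \<open>The backprojected kernel\<close>

text \<open>A density, unlike \<open>restrict_space\<close>, keeps the Borel sets of the whole line measurable.\<close>

definition arc_measure :: "real measure" where
  "arc_measure = density lborel (indicator {0..<2 * pi})"

definition dir :: "real \<Rightarrow> real^2" where
  "dir \<phi> = vector [cos \<phi>, sin \<phi>]"

lemma dir_nth [simp]: "dir \<phi> $ 1 = cos \<phi>" "dir \<phi> $ 2 = sin \<phi>"
  by (simp_all add: dir_def)

lemma norm_dir [simp]: "norm (dir \<phi>) = 1"
  by (simp add: norm_eq_1 inner_real2 power2_eq_square[symmetric])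

lemma continuous_on_dir: "continuous_on A dir"
  unfolding dir_def vector_2_eq by (intro continuous_intros)

lemma measurable_dir [measurable]: "dir \<in> borel_measurable borel"
  by (intro borel_measurable_continuous_onI continuous_on_dir)

lemma linear_perp: "linear perp"
  by (rule linearI) (simp_all add: vec_eq_iff forall_2)

lemma continuous_on_perp: "continuous_on A perp"
  using linear_perp by (simp add: linear_continuous_on linear_linear)

lemma measurable_perp [measurable]: "perp \<in> borel_measurable borel"
  by (intro borel_measurable_continuous_onI continuous_on_perp)

lemma norm_perp [simp]: "norm (perp x) = norm x"
  by (simp add: norm_eq_sqrt_inner inner_real2)

lemma sets_arc [measurable_cong]: "sets arc_measure = sets borel"
  by (simp add: arc_measure_def)

lemma finite_measure_arc: "finite_measure arc_measure"
  unfolding arc_measure_def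
  by (intro finite_measureI) (simp add: emeasure_density)

interpretation arc: finite_measure arc_measure
  by (rule finite_measure_arc)

interpretation arc_lborel: pair_sigma_finite arc_measure "lborel :: 'a::euclidean_space measure" ..

text \<open>Closing the interval adds the null point \<open>2 * pi\<close>. The compact interval is
  what the fundamental theorem of calculus asks for, while the half-open one matches the measure on
  the circle.\<close>

lemma integral_arc:
  fixes f :: "real \<Rightarrow> 'a::{banach, second_countable_topology}"
  assumes [measurable]: "f \<in> borel_measurable borel"
  shows "(\<integral>\<phi>. f \<phi> \<partial>arc_measure) = (\<integral>\<phi>. indicator {0..2 * pi} \<phi> *\<^sub>R f \<phi> \<partial>lborel)"
proof -
  have "arc_measure = density lborel (\<lambda>\<phi>. ennreal (indicator {0..<2 * pi} \<phi>))"
    unfolding arc_measure_def by (simp add: ennreal_indicator)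
  then have "(\<integral>\<phi>. f \<phi> \<partial>arc_measure) = (\<integral>\<phi>. f \<phi> \<partial>density lborel (\<lambda>\<phi>. ennreal (indicator {0..<2 * pi} \<phi>)))"
    by simp
  also have "\<dots> = (\<integral>\<phi>. indicator {0..<2 * pi} \<phi> *\<^sub>R f \<phi> \<partial>lborel)"
    by (subst integral_density) auto
  also have "\<dots> = (\<integral>\<phi>. indicator {0..2 * pi} \<phi> *\<^sub>R f \<phi> \<partial>lborel)"
    by (rule integral_discrete_difference[where X="{2 * pi}"]) (auto simp: indicator_def)
  finally show ?thesis .
qed

lemma AE_arc: "AE \<phi> in arc_measure. \<phi> \<in> {0..2 * pi}"
  unfolding arc_measure_def by (subst AE_density) (auto simp: indicator_def)

text \<open>A primitive of \<open>E\<close> changes by a constant over every period.\<close>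

lemma integral_arc_shift:
  fixes E :: "complex \<Rightarrow> complex"
  assumes hol: "E holomorphic_on UNIV" and per: "\<And>w. E (w + 2 * of_real pi) = E w"
  shows "(\<integral>\<phi>. E (of_real \<phi> + \<i> * of_real \<tau>) \<partial>arc_measure) = (\<integral>\<phi>. E (of_real \<phi>) \<partial>arc_measure)"
proof -
  obtain P where P: "\<And>w. (P has_field_derivative E w) (at w)"
    using holomorphic_convex_primitive'[OF convex_UNIV open_UNIV hol] by auto
  have E: "continuous_on A E" for A
    using hol holomorphic_on_imp_continuous_on continuous_on_subset by blast
  have "((\<lambda>w. P (w + 2 * of_real pi) - P w) has_field_derivative (E (w + 2 * of_real pi) - E w)) (at w)" for w
    by (rule DERIV_diff[OF DERIV_shift[THEN iffD1, OF P] P])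
  then have "\<exists>c. \<forall>w. P (w + 2 * of_real pi) - P w = c"
    using has_field_derivative_zero_constant[of UNIV "\<lambda>w. P (w + 2 * of_real pi) - P w"] per by simp
  then obtain c where c: "\<And>w. P (w + 2 * of_real pi) - P w = c" by blast
  have "(\<integral>\<phi>. E (of_real \<phi> + \<i> * of_real t) \<partial>arc_measure) = c" for t
  proof -
    have "((\<lambda>x. P (of_real x + \<i> * of_real t)) has_vector_derivative E (of_real x + \<i> * of_real t)) (at x within A)" for x A
    proof -
      have "((\<lambda>w. P (w + \<i> * of_real t)) has_field_derivative E (of_real x + \<i> * of_real t)) (at (of_real x))"
        by (rule DERIV_shift[THEN iffD1, OF P])
      then show ?thesis
        by (rule has_vector_derivative_at_within[OF has_vector_derivative_real_field])
    qed
    then have "(\<integral>\<phi>. indicator {0..2 * pi} \<phi> *\<^sub>R E (of_real \<phi> + \<i> * of_real t) \<partial>lborel)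
       = P (of_real (2 * pi) + \<i> * of_real t) - P (of_real 0 + \<i> * of_real t)"
      by (intro integral_FTC_Icc continuous_on_compose2[OF E[of UNIV]] continuous_intros) auto
    also have "\<dots> = c"
      using c[of "\<i> * of_real t"] by (simp add: add.commute)
    finally show ?thesis by (subst integral_arc)
      (auto intro!: borel_measurable_continuous_onI continuous_on_compose2[OF E[of UNIV]] continuous_intros)
  qed
  from this[of \<tau>] this[of 0] show ?thesis by simp
qed

lemma integrable_arc:
  fixes f :: "real \<Rightarrow> 'a::{banach, second_countable_topology}"
  assumes "continuous_on UNIV f"
  shows "integrable arc_measure f"
proof -
  have "bounded (f ` {0..2*pi})"
    by (intro compact_imp_bounded compact_continuous_image continuous_on_subset[OF assms]) auto
  then obtain B where B: "\<And>x. x \<in> {0..2*pi} \<Longrightarrow> norm (f x) \<le> B"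
    by (auto simp: bounded_iff simp del: atLeastAtMost_iff)
  have [measurable]: "f \<in> borel_measurable borel"
    using assms by (rule borel_measurable_continuous_onI)
  show ?thesis
    by (rule arc.integrable_const_bound[OF eventually_mono[OF AE_arc B]]) measurable
qed

lemma integral_arc_exp_cos:
  fixes z :: "real^2"
  assumes u: "u > 0"
  shows "(\<integral>\<phi>. exp (- \<mu> * (z \<bullet> perp (dir \<phi>))) * cos (sqrt (u\<^sup>2 + \<mu>\<^sup>2) * (z \<bullet> dir \<phi>)) \<partial>arc_measure)
       = (\<integral>\<phi>. cos (u * (z \<bullet> dir \<phi>)) \<partial>arc_measure)"
proof -
  define \<tau> where "\<tau> = arsinh (\<mu> / u)"
  \<comment> \<open>\<open>E \<phi> = exp (i u z \<bullet> \<theta>(\<phi>))\<close>; the shift by \<open>i \<tau>\<close> with \<open>u sinh \<tau> = \<mu>\<close> yields the left-hand integrand\<close>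
  define E where "E w = exp (\<i> * of_real u * (of_real (z $ 1) * cos w + of_real (z $ 2) * sin w))" for w
  have s: "u * sinh \<tau> = \<mu>" using u by (simp add: \<tau>_def)
  have c: "u * cosh \<tau> = sqrt (u\<^sup>2 + \<mu>\<^sup>2)"
  proof -
    have "u * cosh \<tau> = sqrt ((u * cosh \<tau>)\<^sup>2)"
      using u by (simp add: cosh_real_nonneg)
    also have "(u * cosh \<tau>)\<^sup>2 = u\<^sup>2 + (u * sinh \<tau>)\<^sup>2"
      by (simp add: cosh_square_eq power_mult_distrib algebra_simps)
    finally show ?thesis by (simp add: s)
  qed
  have hol: "E holomorphic_on UNIV"
    unfolding E_def by (intro holomorphic_intros)
  have "cos (2 * complex_of_real pi) = 1" "sin (2 * complex_of_real pi) = 0"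
    by (metis cos_of_real cos_two_pi of_real_1 of_real_mult of_real_numeral,
        metis sin_of_real sin_two_pi of_real_0 of_real_mult of_real_numeral)
  then have per: "E (w + 2 * of_real pi) = E w" for w
    unfolding E_def by (simp add: cos_add sin_add)
  have E0: "Re (E (of_real \<phi>)) = cos (u * (z \<bullet> dir \<phi>))" for \<phi>
    unfolding E_def by (simp add: inner_real2 Re_exp algebra_simps cos_of_real sin_of_real)
  \<comment> \<open>At a complex angle the direction becomes \<open>cosh \<tau>\<close> times
    \<open>dir \<phi>\<close> plus i \<open>sinh \<tau>\<close> times
    \<open>perp (dir \<phi>)\<close>. Multiplication by i u therefore makes the \<open>perp\<close>
    part a real exponential and leaves an oscillation of frequency \<open>u * cosh \<tau>\<close>
    along \<open>dir \<phi>\<close>.\<close>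
  have E1: "Re (E (of_real \<phi> + \<i> * of_real \<tau>))
      = exp (- \<mu> * (z \<bullet> perp (dir \<phi>))) * cos (sqrt (u\<^sup>2 + \<mu>\<^sup>2) * (z \<bullet> dir \<phi>))" for \<phi>
  proof -
    have "cos (of_real \<phi> + \<i> * of_real \<tau>) = of_real (cos \<phi> * cosh \<tau>) - \<i> * of_real (sin \<phi> * sinh \<tau>)"
      by (simp add: complex_eq_iff Re_cos Im_cos cosh_field_def sinh_field_def field_simps)
    moreover have "sin (of_real \<phi> + \<i> * of_real \<tau>) = of_real (sin \<phi> * cosh \<tau>) + \<i> * of_real (cos \<phi> * sinh \<tau>)"
      by (simp add: complex_eq_iff Re_sin Im_sin cosh_field_def sinh_field_def field_simps)
    ultimately have "\<i> * of_real u * (of_real (z $ 1) * cos (of_real \<phi> + \<i> * of_real \<tau>) + of_real (z $ 2) * sin (of_real \<phi> + \<i> * of_real \<tau>))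
       = Complex (- (u * sinh \<tau>) * (z \<bullet> perp (dir \<phi>))) ((u * cosh \<tau>) * (z \<bullet> dir \<phi>))"
      by (simp add: complex_eq_iff inner_real2 algebra_simps)
    then show ?thesis unfolding E_def by (simp add: Re_exp s c)
  qed
  have i: "integrable arc_measure (\<lambda>\<phi>. E (of_real \<phi> + \<i> * of_real t))" for t
    unfolding E_def by (intro integrable_arc continuous_intros)
  have "(\<integral>\<phi>. Re (E (of_real \<phi> + \<i> * of_real \<tau>)) \<partial>arc_measure) = Re (\<integral>\<phi>. E (of_real \<phi> + \<i> * of_real \<tau>) \<partial>arc_measure)"
    using i by (simp add: integral_Re)
  also have "\<dots> = Re (\<integral>\<phi>. E (of_real \<phi>) \<partial>arc_measure)"
    by (subst integral_arc_shift[OF hol per]) simp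
  also have "\<dots> = (\<integral>\<phi>. Re (E (of_real \<phi>)) \<partial>arc_measure)"
    using i[of 0] by (simp add: integral_Re)
  finally show ?thesis by (simp only: E0 E1)
qed


section \<open>Polar coordinates in the plane\<close>

lemma integral_ball_polar:
  fixes h :: "real^2 \<Rightarrow> real"
  assumes cont: "continuous_on UNIV h" and R: "R > 0"
  shows "(\<integral>\<xi>. indicator (ball 0 R) \<xi> * h \<xi> \<partial>lborel)
       = (\<integral>u. indicator {0..R} u * (u * (\<integral>\<phi>. h (u *\<^sub>R dir \<phi>) \<partial>arc_measure)) \<partial>lborel)"
proof -
  define g where "g v = v $ 1 *\<^sub>R dir (v $ 2)" for v :: "real^2"
  define g' where "g' v k = k $ 1 *\<^sub>R dir (v $ 2) + (v $ 1 * k $ 2) *\<^sub>R perp (dir (v $ 2))" for v k :: "real^2"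
  \<comment> \<open>The rectangle is open, which leaves out radius 0 and the coinciding angles 0 and
    \<open>2 * pi\<close>, where the polar map is not injective.\<close>
  define S :: "(real^2) set" where "S = box (vector [0, 0]) (vector [R, 2 * pi])"
  have S: "v \<in> S \<longleftrightarrow> 0 < v $ 1 \<and> v $ 1 < R \<and> 0 < v $ 2 \<and> v $ 2 < 2 * pi" for v
    by (auto simp: S_def box_def Basis_real2 inner_axis)
  have hm[measurable]: "h \<in> borel_measurable borel"
    using cont by (rule borel_measurable_continuous_onI)
  have gcont: "continuous_on UNIV g"
    unfolding g_def by (intro continuous_intros continuous_on_compose2[OF continuous_on_dir[of UNIV]]) auto
  have hgcont: "continuous_on UNIV (\<lambda>v. h (g v))"
    by (intro continuous_on_compose2[OF cont gcont]) auto
  have der: "(g has_derivative g' v) (at v within S)" for v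
  proof -
    have "g = (\<lambda>v. (v $ 1 * cos (v $ 2)) *\<^sub>R axis 1 1 + (v $ 1 * sin (v $ 2)) *\<^sub>R axis 2 1)"
      by (rule ext) (simp add: g_def dir_def vector_2_eq scaleR_add_right)
    moreover have "g' v = (\<lambda>k. (k $ 1 * cos (v $ 2) - v $ 1 * sin (v $ 2) * k $ 2) *\<^sub>R axis 1 1
       + (k $ 1 * sin (v $ 2) + v $ 1 * cos (v $ 2) * k $ 2) *\<^sub>R axis 2 1)"
      by (rule ext) (simp add: g'_def vec_eq_iff forall_2 axis_def)
    moreover have "((\<lambda>x. x $ i) has_derivative (\<lambda>x. x $ i)) (at v within S)" for i
      by (rule bounded_linear_imp_has_derivative[OF bounded_linear_vec_nth])
    ultimately show ?thesis
      by (auto intro!: derivative_eq_intros simp: algebra_simps)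
  qed
  have det: "det (matrix (g' v)) = v $ 1" for v
  proof -
    have "det (matrix (g' v)) = v $ 1 * (cos (v $ 2) * cos (v $ 2)) + v $ 1 * (sin (v $ 2) * sin (v $ 2))"
      by (simp add: det_2 matrix_def g'_def axis_def algebra_simps)
    also have "\<dots> = v $ 1 * ((cos (v $ 2))\<^sup>2 + (sin (v $ 2))\<^sup>2)"
      by (simp only: power2_eq_square distrib_left)
    finally show ?thesis by simp
  qed
  have inj: "inj_on g S"
  proof (rule inj_onI)
    fix v w assume vw: "v \<in> S" "w \<in> S" "g v = g w"
    have "norm (g v) = v $ 1" "norm (g w) = w $ 1" using vw(1,2) by (auto simp: g_def S)
    then have 1: "v $ 1 = w $ 1" using vw(3) by simp
    then have "dir (v $ 2) = dir (w $ 2)" using vw by (simp add: g_def S)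
    then have "sin (v $ 2) = sin (w $ 2) \<and> cos (v $ 2) = cos (w $ 2)"
      by (metis dir_nth)
    then obtain n :: int where n: "v $ 2 = w $ 2 + 2 * pi * of_int n"
      using sin_cos_eq_iff by metis
    have "\<bar>v $ 2 - w $ 2\<bar> < 2 * pi" using vw by (auto simp: S abs_if)
    then have "\<bar>2 * pi * of_int n\<bar> < 2 * pi * 1" using n by simp
    then have "\<bar>real_of_int n\<bar> < 1" by (simp add: abs_mult)
    then have "n = 0" by linarith
    then show "v = w" using n 1 by (simp add: vec_eq_iff forall_2)
  qed
  \<comment> \<open>The image misses only points of the nonnegative first axis. Removing that entire
    axis is harmless, since it is negligible.\<close>
  have im: "ball 0 R - {v. v $ 2 = 0} \<subseteq> g ` S" "g ` S \<subseteq> ball 0 R"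
  proof -
    show "g ` S \<subseteq> ball 0 R" by (auto simp: g_def S)
    show "ball 0 R - {v. v $ 2 = 0} \<subseteq> g ` S"
    proof
      fix v :: "real^2" assume v: "v \<in> ball 0 R - {v. v $ 2 = 0}"
      then have r: "0 < norm v" "norm v < R" by auto
      have "(v $ 1 / norm v)\<^sup>2 + (v $ 2 / norm v)\<^sup>2 = 1"
        using r by (simp add: power_divide add_divide_distrib[symmetric] norm_real2_sq[symmetric])
      then obtain t where t: "0 \<le> t" "t < 2 * pi" "v $ 1 / norm v = cos t" "v $ 2 / norm v = sin t"
        using sincos_total_2pi by metis
      have "t \<noteq> 0" using t(4) v r by auto
      then have "vector [norm v, t] \<in> S" using t r by (simp add: S)
      moreover have "v $ 1 = norm v * cos t" "v $ 2 = norm v * sin t"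
        unfolding t(3,4)[symmetric] using r by simp_all
      then have "g (vector [norm v, t]) = v"
        by (simp add: g_def vec_eq_iff forall_2)
      ultimately show "v \<in> g ` S" by (metis imageI)
    qed
  qed
  have Sl: "S \<in> sets lebesgue" by (simp add: S_def)
  have ai: "(\<lambda>v. v $ 1 * h (g v)) absolutely_integrable_on S"
  proof -
    have "(\<lambda>v. v $ 1 * h (g v)) absolutely_integrable_on cbox (vector [0, 0]) (vector [R, 2 * pi])"
      by (intro absolutely_integrable_continuous continuous_intros continuous_on_subset[OF hgcont]) auto
    then show ?thesis
      by (rule set_integrable_subset) (auto simp: S_def box_subset_cbox Sl[unfolded S_def])
  qed
  have bi: "integrable lborel (\<lambda>v. indicator S v * (v $ 1 * h (g v)))"
  proof -
    have "continuous_on UNIV (\<lambda>v. v $ 1 * h (g v))" by (intro continuous_intros hgcont)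
    then have [measurable]: "(\<lambda>v. v $ 1 * h (g v)) \<in> borel_measurable borel"
      by (rule borel_measurable_continuous_onI)
    have "S \<in> sets borel" by (simp add: S_def)
    then show ?thesis
      using ai unfolding set_integrable_def by (subst (asm) integrable_completion) auto
  qed
  \<comment> \<open>The change of variables theorem speaks of vector-valued functions, so the real
    values pass through \<open>real^1\<close> by \<open>vec\<close>.\<close>
  have "integral (g ` S) (\<lambda>\<xi>. vec (h \<xi>) :: real^1) = integral S (\<lambda>v. \<bar>det (matrix (g' v))\<bar> *\<^sub>R vec (h (g v)))"
  proof (rule integral_change_of_variables[OF Sl der inj], rule disjI2)
    have "(\<lambda>v. vec (v $ 1 * h (g v)) :: real^1) absolutely_integrable_on S"
      using ai by (simp add: absolutely_integrable_on_1_iff)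
    then show "(\<lambda>v. \<bar>det (matrix (g' v))\<bar> *\<^sub>R (vec (h (g v)) :: real^1)) absolutely_integrable_on S"
      by (rule set_integrable_cong[THEN iffD1, rotated 3]) (auto simp: det S vec_eq_iff)
  qed
  also have "integral S (\<lambda>v. \<bar>det (matrix (g' v))\<bar> *\<^sub>R (vec (h (g v)) :: real^1))
      = integral S (\<lambda>v. vec (v $ 1 * h (g v)))"
    by (rule integral_cong) (auto simp: det S vec_eq_iff)
  finally have cv: "integral (g ` S) h = integral S (\<lambda>v. v $ 1 * h (g v))"
    by (simp add: integral_on_1_eq)
  have "(\<integral>\<xi>. indicator (ball 0 R) \<xi> * h \<xi> \<partial>lborel) = integral (ball 0 R) h"
  proof -
    have "set_integrable lborel (cball 0 R) h"
      unfolding set_integrable_def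
      by (intro borel_integrable_compact continuous_on_subset[OF cont]) auto
    then have "set_integrable lborel (ball 0 R) h"
      by (rule set_integrable_subset) auto
    from set_borel_integral_eq_integral(2)[OF this] show ?thesis
      by (simp add: set_lebesgue_integral_def)
  qed
  also have "\<dots> = integral (g ` S) h"
  proof (rule integral_spike_set)
    show "negligible {v \<in> ball 0 R - g ` S. h v \<noteq> 0}"
      by (rule negligible_subset[OF negligible_standard_hyperplane_cart[of 2]]) (use im in auto)
    show "negligible {v \<in> g ` S - ball 0 R. h v \<noteq> 0}"
      by (rule negligible_subset[OF negligible_empty]) (use im in auto)
  qed
  also have "\<dots> = (\<integral>v. indicator S v * (v $ 1 * h (g v)) \<partial>lborel)"
    using set_borel_integral_eq_integral(2)[of S "\<lambda>v. v $ 1 * h (g v)"] bi cv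
    by (simp add: set_lebesgue_integral_def set_integrable_def)
  also have "\<dots> = (\<integral>p. indicator {0<..<R} (fst p) * (fst p * (indicator {0<..<2 * pi} (snd p) * h (fst p *\<^sub>R dir (snd p)))) \<partial>(lborel \<Otimes>\<^sub>M lborel))"
    using bi by (subst lborel_real2_eq_distr[symmetric], subst integral_distr)
       (auto simp: g_def S indicator_def intro!: Bochner_Integration.integral_cong)
  also have "\<dots> = (\<integral>u. (\<integral>\<phi>. indicator {0<..<R} u * (u * (indicator {0<..<2 * pi} \<phi> * h (u *\<^sub>R dir \<phi>))) \<partial>lborel) \<partial>lborel)"
  proof -
    have "integrable (lborel \<Otimes>\<^sub>M lborel) (\<lambda>p. indicator {0<..<R} (fst p) * (fst p * (indicator {0<..<2 * pi} (snd p) * h (fst p *\<^sub>R dir (snd p)))))"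
      using bi
      by (subst (asm) lborel_real2_eq_distr[symmetric], subst (asm) integrable_distr_eq)
         (auto simp: g_def S indicator_def elim!: Bochner_Integration.integrable_cong[THEN iffD1, rotated 2])
    from lborel_pair.integral_fst'[OF this] show ?thesis by simp
  qed
  also have "\<dots> = (\<integral>u. indicator {0<..<R} u * (u * (\<integral>\<phi>. h (u *\<^sub>R dir \<phi>) \<partial>arc_measure)) \<partial>lborel)"
  proof -
    have "(\<integral>\<phi>. indicator {0<..<2 * pi} \<phi> * h (u *\<^sub>R dir \<phi>) \<partial>lborel) = (\<integral>\<phi>. h (u *\<^sub>R dir \<phi>) \<partial>arc_measure)" for u
      by (subst integral_arc, measurable, rule integral_discrete_difference[where X="{0, 2 * pi}"])
         (auto simp: indicator_def)
    then show ?thesis by simp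
  qed
  also have "\<dots> = (\<integral>u. indicator {0..R} u * (u * (\<integral>\<phi>. h (u *\<^sub>R dir \<phi>) \<partial>arc_measure)) \<partial>lborel)"
    by (rule integral_discrete_difference[where X="{0, R}"]) (auto simp: indicator_def)
  finally show ?thesis .
qed

text \<open>Substitution \<open>r = sqrt (u\<^sup>2 + \<mu>\<^sup>2)\<close>; it is smooth at \<open>u = 0\<close> because \<open>\<mu> \<noteq> 0\<close>.\<close>

lemma radon_kernel_eq:
  assumes \<rho>: "\<rho> > 0" and \<mu>: "\<mu> \<noteq> 0"
  shows "radon_kernel \<mu> \<rho> t = 1 / pi * (\<integral>u. indicator {0..1 / \<rho>} u * (u * cos (t * sqrt (u\<^sup>2 + \<mu>\<^sup>2))) \<partial>lborel)"
proof -
  define g where "g u = sqrt (u\<^sup>2 + \<mu>\<^sup>2)" for u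
  define g' where "g' u = u / sqrt (u\<^sup>2 + \<mu>\<^sup>2)" for u
  have pos: "u\<^sup>2 + \<mu>\<^sup>2 > 0" for u using \<mu> by (simp add: add_nonneg_pos)
  have "(LBINT r. (r * cos (t * r)) * indicator {g 0..g (1 / \<rho>)} r)
    = (LBINT u. (g u * cos (t * g u)) * g' u * indicator {0..1 / \<rho>} u)"
  proof (rule integral_substitution)
    show "set_integrable lborel {g 0..g (1 / \<rho>)} (\<lambda>r. r * cos (t * r))"
      by (intro borel_integrable_atLeastAtMost' continuous_intros)
    show "(g has_real_derivative g' u) (at u)" for u
      unfolding g_def g'_def using pos[of u]
      by (auto intro!: derivative_eq_intros simp: field_simps)
    show "continuous_on {0..1 / \<rho>} g'"
      unfolding g'_def using pos by (intro continuous_intros) (auto simp: less_imp_neq[symmetric])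
    show "g' u \<ge> 0" if "u \<in> {0..1 / \<rho>}" for u using that by (simp add: g'_def)
  qed (use \<rho> in auto)
  also have "(\<lambda>u. (g u * cos (t * g u)) * g' u * indicator {0..1 / \<rho>} u) = (\<lambda>u. indicator {0..1 / \<rho>} u * (u * cos (t * sqrt (u\<^sup>2 + \<mu>\<^sup>2))))"
    using pos by (auto simp: fun_eq_iff g_def g'_def field_simps)
  finally have "(LBINT r. (r * cos (t * r)) * indicator {g 0..g (1 / \<rho>)} r)
    = (\<integral>u. indicator {0..1 / \<rho>} u * (u * cos (t * sqrt (u\<^sup>2 + \<mu>\<^sup>2))) \<partial>lborel)" .
  moreover have "g 0 = \<bar>\<mu>\<bar>" "g (1 / \<rho>) = sqrt (1 / \<rho>\<^sup>2 + \<mu>\<^sup>2)"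
    by (simp_all add: g_def power_divide)
  ultimately show ?thesis
    by (simp add: radon_kernel_def set_lebesgue_integral_def mult.commute)
qed

section \<open>The kernel averaged over directions\<close>

lemma measurable_radon_kernel [measurable]: "radon_kernel \<mu> \<rho> \<in> borel_measurable borel"
  unfolding radon_kernel_def set_lebesgue_integral_def by measurable

lemma integrable_indicator_times: "integrable lborel (\<lambda>u::real. indicator {0..R} u * u)"
  using borel_integrable_compact[of "{0..R}" "\<lambda>u. u"] by (simp add: continuous_intros)

lemma bounded_radon_kernel:
  obtains C where "\<And>t. \<bar>radon_kernel \<mu> \<rho> t\<bar> \<le> C"
proof
  let ?A = "{\<bar>\<mu>\<bar>..sqrt (1 / \<rho>\<^sup>2 + \<mu>\<^sup>2)}"
  fix t
  have i: "integrable lborel (\<lambda>r. indicator ?A r *\<^sub>R f r)" if "continuous_on UNIV f" for f :: "real \<Rightarrow> real"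
    by (intro borel_integrable_compact continuous_on_subset[OF that]) auto
  have "\<bar>\<integral>r. indicator ?A r *\<^sub>R (r * cos (t * r)) \<partial>lborel\<bar> \<le> (\<integral>r. indicator ?A r *\<^sub>R \<bar>r\<bar> \<partial>lborel)"
  proof (rule order.trans[OF integral_abs_bound], rule integral_mono)
    show "integrable lborel (\<lambda>r. \<bar>indicator ?A r *\<^sub>R (r * cos (t * r))\<bar>)"
      by (intro integrable_abs i continuous_intros)
    show "integrable lborel (\<lambda>r. indicator ?A r *\<^sub>R \<bar>r\<bar>)"
      by (intro i continuous_intros)
    show "\<bar>indicator ?A r *\<^sub>R (r * cos (t * r))\<bar> \<le> indicator ?A r *\<^sub>R \<bar>r\<bar>" for r
      using mult_left_le[of "\<bar>cos (t * r)\<bar>" "\<bar>r\<bar>"] by (auto simp: indicator_def abs_mult)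
  qed
  then show "\<bar>radon_kernel \<mu> \<rho> t\<bar> \<le> 1 / pi * (\<integral>r. indicator ?A r *\<^sub>R \<bar>r\<bar> \<partial>lborel)"
    by (simp add: radon_kernel_def set_lebesgue_integral_def abs_mult divide_right_mono)
qed

lemma exp_inner_perp_le:
  assumes "norm \<theta> = 1"
  shows "exp (- \<mu> * (z \<bullet> perp \<theta>)) \<le> exp (\<bar>\<mu>\<bar> * norm z)"
proof -
  have "\<bar>\<mu> * (z \<bullet> perp \<theta>)\<bar> \<le> \<bar>\<mu>\<bar> * norm z"
    using Cauchy_Schwarz_ineq2[of z "perp \<theta>"] assms by (simp add: abs_mult mult_left_mono)
  then show ?thesis by simp
qed

text \<open>Fubini puts the angular integral inside, where the circle identity applies at every
  radius u > 0; the remaining factor u is the Jacobian of polar coordinates. The outcome is the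
  Fourier transform of the indicator of a disc, that is, the ideal low-pass kernel.\<close>

lemma integral_arc_radon_kernel:
  assumes \<rho>: "\<rho> > 0" and \<mu>: "\<mu> \<noteq> 0"
  shows "(\<integral>\<phi>. exp (- \<mu> * (z \<bullet> perp (dir \<phi>))) * radon_kernel \<mu> \<rho> (z \<bullet> dir \<phi>) \<partial>arc_measure)
       = 1 / pi * (\<integral>\<xi>. indicator (ball 0 (1 / \<rho>)) \<xi> * cos (\<xi> \<bullet> z) \<partial>lborel)"
proof -
  define F where "F \<phi> u = exp (- \<mu> * (z \<bullet> perp (dir \<phi>))) * (indicator {0..1 / \<rho>} u * u) * cos ((z \<bullet> dir \<phi>) * sqrt (u\<^sup>2 + \<mu>\<^sup>2))" for \<phi> u :: real
  define D where "D \<phi> u = exp (\<bar>\<mu>\<bar> * norm z) * (indicator {0..1 / \<rho>} u * u)" for \<phi> u :: real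
  have D: "integrable (arc_measure \<Otimes>\<^sub>M lborel) (\<lambda>(\<phi>, u). D \<phi> u)"
    unfolding D_def by (intro arc_lborel.integrable_times integrable_indicator_times arc.integrable_const)
  have FD: "norm (F \<phi> u) \<le> norm (D \<phi> u)" for \<phi> u
  proof -
    have "exp (- \<mu> * (z \<bullet> perp (dir \<phi>))) \<le> exp (\<bar>\<mu>\<bar> * norm z)"
      by (rule exp_inner_perp_le) simp
    then have "exp (- \<mu> * (z \<bullet> perp (dir \<phi>))) * \<bar>indicator {0..1 / \<rho>} u * u\<bar> * \<bar>cos ((z \<bullet> dir \<phi>) * sqrt (u\<^sup>2 + \<mu>\<^sup>2))\<bar>
      \<le> exp (\<bar>\<mu>\<bar> * norm z) * \<bar>indicator {0..1 / \<rho>} u * u\<bar> * 1"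
      by (intro mult_mono) auto
    then show ?thesis by (simp add: F_def D_def abs_mult)
  qed
  have F: "integrable (arc_measure \<Otimes>\<^sub>M lborel) (\<lambda>(\<phi>, u). F \<phi> u)"
  proof (rule Bochner_Integration.integrable_bound[OF D])
    show "(\<lambda>(\<phi>, u). F \<phi> u) \<in> borel_measurable (arc_measure \<Otimes>\<^sub>M lborel)"
      unfolding F_def by measurable
  qed (use FD in auto)
  have "(\<integral>\<phi>. exp (- \<mu> * (z \<bullet> perp (dir \<phi>))) * radon_kernel \<mu> \<rho> (z \<bullet> dir \<phi>) \<partial>arc_measure)
    = (\<integral>\<phi>. 1 / pi * (\<integral>u. F \<phi> u \<partial>lborel) \<partial>arc_measure)"
  proof -
    have "exp (- \<mu> * (z \<bullet> perp (dir \<phi>))) * radon_kernel \<mu> \<rho> (z \<bullet> dir \<phi>) = 1 / pi * (\<integral>u. F \<phi> u \<partial>lborel)" for \<phi>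
      unfolding radon_kernel_eq[OF assms] F_def by (simp add: mult.assoc)
    then show ?thesis by (simp only:)
  qed
  also have "\<dots> = 1 / pi * (\<integral>\<phi>. (\<integral>u. F \<phi> u \<partial>lborel) \<partial>arc_measure)"
    by simp
  also have "(\<integral>\<phi>. (\<integral>u. F \<phi> u \<partial>lborel) \<partial>arc_measure) = (\<integral>u. (\<integral>\<phi>. F \<phi> u \<partial>arc_measure) \<partial>lborel)"
    by (rule arc_lborel.Fubini_integral[OF F, symmetric])
  also have "\<dots> = (\<integral>u. indicator {0..1 / \<rho>} u * (u * (\<integral>\<phi>. cos ((u *\<^sub>R dir \<phi>) \<bullet> z) \<partial>arc_measure)) \<partial>lborel)"
  proof -
    have "(\<integral>\<phi>. F \<phi> u \<partial>arc_measure) = indicator {0..1 / \<rho>} u * (u * (\<integral>\<phi>. cos ((u *\<^sub>R dir \<phi>) \<bullet> z) \<partial>arc_measure))" for u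
    proof (cases "u > 0")
      case True
      have "(\<integral>\<phi>. F \<phi> u \<partial>arc_measure) = (\<integral>\<phi>. (indicator {0..1 / \<rho>} u * u) *
         (exp (- \<mu> * (z \<bullet> perp (dir \<phi>))) * cos (sqrt (u\<^sup>2 + \<mu>\<^sup>2) * (z \<bullet> dir \<phi>))) \<partial>arc_measure)"
        by (simp add: F_def ac_simps)
      also have "\<dots> = (indicator {0..1 / \<rho>} u * u) * (\<integral>\<phi>. cos (u * (z \<bullet> dir \<phi>)) \<partial>arc_measure)"
        by (simp only: integral_mult_right_zero integral_arc_exp_cos[OF True])
      finally show ?thesis by (simp add: inner_commute mult.assoc)
    next
      \<comment> \<open>The complex shift exists only for u > 0. Here both sides vanish: by the
        factor u at 0, by the indicator below 0.\<close>
      case False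
      then show ?thesis by (simp add: F_def indicator_def)
    qed
    then show ?thesis by simp
  qed
  also have "\<dots> = (\<integral>\<xi>. indicator (ball 0 (1 / \<rho>)) \<xi> * cos (\<xi> \<bullet> z) \<partial>lborel)"
    using \<rho> by (subst integral_ball_polar) (auto intro!: continuous_intros)
  finally show ?thesis .
qed


section \<open>The expectation of the estimator\<close>

text \<open>Functions of independent variables generate smaller \<sigma>-algebras, hence stay
  independent. The maps \<open>g\<close> and \<open>g'\<close> bring values of different types into
  a common one, so that the product rule for expectations becomes available.\<close>

lemma (in prob_space) indep_rv_imp_indep_var:
  assumes "indep_rv M N X N' X'" and g: "g \<in> N \<rightarrow>\<^sub>M S" and g': "g' \<in> N' \<rightarrow>\<^sub>M T"
  shows "indep_var S (\<lambda>\<omega>. g (X \<omega>)) T (\<lambda>\<omega>. g' (X' \<omega>))"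
proof -
  have X[measurable]: "X \<in> M \<rightarrow>\<^sub>M N" and X'[measurable]: "X' \<in> M \<rightarrow>\<^sub>M N'"
    and ind: "indep_set {X -` A \<inter> space M | A. A \<in> sets N} {X' -` B \<inter> space M | B. B \<in> sets N'}"
    using assms(1) by (auto simp: indep_rv_def)
  note g[measurable] g'[measurable]
  have sub: "sigma_sets (space M) {(\<lambda>\<omega>. h (Z \<omega>)) -` A \<inter> space M | A. A \<in> sets U} \<subseteq> {Z -` A \<inter> space M | A. A \<in> sets V}"
    if Z: "Z \<in> M \<rightarrow>\<^sub>M V" and h: "h \<in> V \<rightarrow>\<^sub>M U" for h Z U V
  proof -
    \<comment> \<open>Preimages under one measurable map already form a \<sigma>-algebra, so
      generating adds no new sets.\<close>
    have "sigma_sets (space M) {(\<lambda>\<omega>. h (Z \<omega>)) -` A \<inter> space M | A. A \<in> sets U}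
      = {(\<lambda>\<omega>. h (Z \<omega>)) -` A \<inter> space M | A. A \<in> sets U}"
      using measurable_space[OF Z] measurable_space[OF h]
      by (subst sets_vimage_algebra[symmetric], subst sets_vimage_algebra2) auto
    also have "\<dots> \<subseteq> {Z -` A \<inter> space M | A. A \<in> sets V}"
    proof clarify
      fix A assume "A \<in> sets U"
      then have "h -` A \<inter> space V \<in> sets V" using h by (rule measurable_sets[rotated])
      moreover have "(\<lambda>\<omega>. h (Z \<omega>)) -` A \<inter> space M = Z -` (h -` A \<inter> space V) \<inter> space M"
        using measurable_space[OF Z] by auto
      ultimately show "\<exists>B. (\<lambda>\<omega>. h (Z \<omega>)) -` A \<inter> space M = Z -` B \<inter> space M \<and> B \<in> sets V" by blast
    qed
    finally show ?thesis .
  qed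
  show ?thesis
    unfolding indep_var_eq
  proof (intro conjI indep_setI)
    show "sigma_sets (space M) {(\<lambda>\<omega>. g (X \<omega>)) -` A \<inter> space M | A. A \<in> sets S} \<subseteq> events"
      using sub[OF X g] measurable_sets[OF X] by blast
    show "sigma_sets (space M) {(\<lambda>\<omega>. g' (X' \<omega>)) -` A \<inter> space M | A. A \<in> sets T} \<subseteq> events"
      using sub[OF X' g'] measurable_sets[OF X'] by blast
    show "prob (a \<inter> b) = prob a * prob b"
      if "a \<in> sigma_sets (space M) {(\<lambda>\<omega>. g (X \<omega>)) -` A \<inter> space M | A. A \<in> sets S}"
        and "b \<in> sigma_sets (space M) {(\<lambda>\<omega>. g' (X' \<omega>)) -` A \<inter> space M | A. A \<in> sets T}" for a b
      using that sub[OF X g] sub[OF X' g'] by (intro indep_setD[OF ind]) blast+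
  qed measurable
qed

section \<open>The uniform distribution on the cylinder in angle and offset\<close>

lemma circle_measure_eq: "circle_measure = distr arc_measure borel dir"
proof (rule measure_eqI)
  show "sets circle_measure = sets (distr arc_measure borel dir)" by (simp add: circle_measure_def)
  fix A assume "A \<in> sets circle_measure"
  then have [measurable]: "A \<in> sets borel" by (simp add: circle_measure_def)
  have d: "dir \<in> restrict_space lborel {0..<2 * pi} \<rightarrow>\<^sub>M borel"
    by (intro measurable_restrict_space1) simp
  have B: "dir -` A \<in> sets borel" using measurable_sets[OF measurable_dir, of A] by simp
  have "emeasure circle_measure A = emeasure lborel (dir -` A \<inter> {0..<2 * pi})"
    unfolding circle_measure_def dir_def[symmetric]
    using d by (simp add: emeasure_distr emeasure_restrict_space space_restrict_space Int_commute)
  also have "\<dots> = emeasure (distr arc_measure borel dir) A"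
    using B by (simp add: emeasure_distr arc_measure_def emeasure_density indicator_inter_arith[symmetric] Int_commute
        nn_integral_indicator)
  finally show "emeasure circle_measure A = emeasure (distr arc_measure borel dir) A" .
qed

lemma measurable_dir_pair [measurable]:
  "(\<lambda>p. (dir (fst p), snd p)) \<in> arc_measure \<Otimes>\<^sub>M lborel \<rightarrow>\<^sub>M (borel :: ((real^2) \<times> real) measure)"
  unfolding borel_prod[symmetric] by measurable

text \<open>The circle has length \<open>2 * pi\<close> and the interval of offsets has length 2, so
  normalisation divides by \<open>4 * pi\<close>.\<close>

lemma uniform_Z_eq:
  "uniform_Z = density (distr (arc_measure \<Otimes>\<^sub>M lborel) borel (\<lambda>p. (dir (fst p), snd p)))
     (\<lambda>p. ennreal (indicator (sphere 0 1 \<times> {-1..1}) p / (4 * pi)))"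
proof -
  have fin: "finite_measure circle_measure"
    unfolding circle_measure_eq by (intro arc.finite_measure_distr) simp
  have prod: "circle_measure \<Otimes>\<^sub>M lborel = distr (arc_measure \<Otimes>\<^sub>M lborel) (borel :: ((real^2) \<times> real) measure) (\<lambda>p. (dir (fst p), snd p))"
  proof -
    have "circle_measure \<Otimes>\<^sub>M lborel = distr arc_measure borel dir \<Otimes>\<^sub>M distr lborel borel (\<lambda>x::real. x)"
      unfolding circle_measure_eq by (simp add: distr_id2)
    also have "\<dots> = distr (arc_measure \<Otimes>\<^sub>M lborel) (borel \<Otimes>\<^sub>M borel) (\<lambda>(x, y). (dir x, y))"
      by (rule pair_measure_distr) (auto simp: distr_id2 lborel.sigma_finite_measure_axioms)
    finally show ?thesis by (simp add: borel_prod case_prod_unfold)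
  qed
  have "emeasure circle_measure (sphere 0 1) = ennreal (2 * pi)"
    by (simp add: circle_measure_eq emeasure_distr vimage_def arc_measure_def emeasure_density)
  then have "emeasure (circle_measure \<Otimes>\<^sub>M lborel) (sphere 0 1 \<times> {-1..1::real}) = ennreal (2 * pi) * ennreal 2"
    by (subst lborel.emeasure_pair_measure_Times) (auto simp: circle_measure_def)
  also have "\<dots> = ennreal (4 * pi)"
    by (subst ennreal_mult[symmetric]) auto
  finally have e: "emeasure (circle_measure \<Otimes>\<^sub>M lborel) (sphere 0 1 \<times> {-1..1::real}) = ennreal (4 * pi)" .
  have "indicator (sphere 0 1 \<times> {-1..1}) p / ennreal (4 * pi) = ennreal (indicator (sphere 0 1 \<times> {-1..1}) p / (4 * pi))" for p :: "(real^2) \<times> real"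
    by (simp add: divide_ennreal[symmetric] ennreal_indicator)
  then show ?thesis
    unfolding uniform_Z_def uniform_measure_def e by (simp add: prod)
qed

lemma
  fixes h :: "(real^2) \<times> real \<Rightarrow> real"
  assumes [measurable]: "h \<in> borel_measurable borel"
  shows integrable_uniform_Z: "integrable uniform_Z h \<longleftrightarrow>
      integrable (arc_measure \<Otimes>\<^sub>M lborel) (\<lambda>p. indicator {-1..1} (snd p) * h (dir (fst p), snd p))"
    and integral_uniform_Z: "(\<integral>p. h p \<partial>uniform_Z)
      = 1 / (4 * pi) * (\<integral>p. indicator {-1..1} (snd p) * h (dir (fst p), snd p) \<partial>(arc_measure \<Otimes>\<^sub>M lborel))"
proof -
  have [measurable]: "(sphere 0 1 \<times> {-1..1}) \<in> sets (borel :: ((real^2) \<times> real) measure)"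
    unfolding borel_prod[symmetric] by (intro pair_measureI) auto
  \<comment> \<open>Every \<open>dir\<close> lies on the unit circle, so only the restriction of the
    offset survives from the indicator.\<close>
  have eq: "(indicator (sphere 0 1 \<times> {-1..1}) (dir (fst p), snd p) / (4 * pi)) *\<^sub>R h (dir (fst p), snd p)
      = 1 / (4 * pi) * (indicator {-1..1} (snd p) * h (dir (fst p), snd p))" for p
    by (simp add: indicator_def)
  have "integrable uniform_Z h \<longleftrightarrow> integrable (arc_measure \<Otimes>\<^sub>M lborel)
      (\<lambda>p. 1 / (4 * pi) * (indicator {-1..1} (snd p) * h (dir (fst p), snd p)))"
    unfolding uniform_Z_eq eq[symmetric]
    by (subst integrable_density, simp, simp, simp, subst integrable_distr_eq) auto
  also have "\<dots> \<longleftrightarrow> integrable (arc_measure \<Otimes>\<^sub>M lborel) (\<lambda>p. indicator {-1..1} (snd p) * h (dir (fst p), snd p))"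
    by (subst integrable_mult_left_iff) simp
  finally show "integrable uniform_Z h \<longleftrightarrow>
      integrable (arc_measure \<Otimes>\<^sub>M lborel) (\<lambda>p. indicator {-1..1} (snd p) * h (dir (fst p), snd p))" .
  have "(\<integral>p. h p \<partial>uniform_Z) = (\<integral>p. 1 / (4 * pi) * (indicator {-1..1} (snd p) * h (dir (fst p), snd p)) \<partial>(arc_measure \<Otimes>\<^sub>M lborel))"
    unfolding uniform_Z_eq eq[symmetric]
    by (subst integral_density, simp, simp, simp, subst integral_distr) auto
  then show "(\<integral>p. h p \<partial>uniform_Z)
      = 1 / (4 * pi) * (\<integral>p. indicator {-1..1} (snd p) * h (dir (fst p), snd p) \<partial>(arc_measure \<Otimes>\<^sub>M lborel))"
    by (simp only: integral_mult_right_zero)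
qed

section \<open>Bounds for the exponential Radon transform and the estimator weights\<close>

lemma exp_radon_eq:
  assumes [measurable]: "f \<in> borel_measurable borel"
  shows "exp_radon \<mu> f \<theta> s = (\<integral>t. exp (\<mu> * ((s *\<^sub>R \<theta> + t *\<^sub>R perp \<theta>) \<bullet> perp \<theta>)) * f (s *\<^sub>R \<theta> + t *\<^sub>R perp \<theta>) \<partial>lborel)"
  unfolding exp_radon_def line_measure_def by (subst integral_distr) auto

lemma measurable_exp_radon [measurable]:
  assumes [measurable]: "f \<in> borel_measurable borel"
  shows "(\<lambda>p. exp_radon \<mu> f (fst p) (snd p)) \<in> borel_measurable (borel :: ((real^2) \<times> real) measure)"
  unfolding exp_radon_eq[OF assms] borel_prod[symmetric] by measurable

lemma frame_coordinates:
  assumes "norm \<theta> = 1"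
  shows "(s *\<^sub>R \<theta> + t *\<^sub>R perp \<theta>) \<bullet> \<theta> = s" and "(s *\<^sub>R \<theta> + t *\<^sub>R perp \<theta>) \<bullet> perp \<theta> = t"
    and "\<bar>s\<bar> \<le> norm (s *\<^sub>R \<theta> + t *\<^sub>R perp \<theta>)" and "\<bar>t\<bar> \<le> norm (s *\<^sub>R \<theta> + t *\<^sub>R perp \<theta>)"
proof -
  have *: "\<theta> \<bullet> \<theta> = 1" "perp \<theta> \<bullet> perp \<theta> = 1" "\<theta> \<bullet> perp \<theta> = 0" "perp \<theta> \<bullet> \<theta> = 0"
    using assms by (simp_all add: dot_square_norm) (simp_all add: inner_real2)
  show 1: "(s *\<^sub>R \<theta> + t *\<^sub>R perp \<theta>) \<bullet> \<theta> = s" and 2: "(s *\<^sub>R \<theta> + t *\<^sub>R perp \<theta>) \<bullet> perp \<theta> = t"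
    using * by (simp_all add: inner_add_left)
  show "\<bar>s\<bar> \<le> norm (s *\<^sub>R \<theta> + t *\<^sub>R perp \<theta>)" "\<bar>t\<bar> \<le> norm (s *\<^sub>R \<theta> + t *\<^sub>R perp \<theta>)"
    using Cauchy_Schwarz_ineq2[of "s *\<^sub>R \<theta> + t *\<^sub>R perp \<theta>" \<theta>] Cauchy_Schwarz_ineq2[of "s *\<^sub>R \<theta> + t *\<^sub>R perp \<theta>" "perp \<theta>"]
    unfolding 1 2 using assms by simp_all
qed


lemma exp_radon_unit:
  assumes f: "f \<in> borel_measurable borel" and "norm \<theta> = 1"
  shows "exp_radon \<mu> f \<theta> s = (\<integral>t. exp (\<mu> * t) * f (s *\<^sub>R \<theta> + t *\<^sub>R perp \<theta>) \<partial>lborel)"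
  unfolding exp_radon_eq[OF f] by (simp only: frame_coordinates[OF assms(2)])

text \<open>A point of the line can lie in the unit ball only if its coordinate satisfies
  \<bar>t\<bar> \<le> 1. The factor 2 is the length of that interval, and the exponential is bounded
  there by \<open>exp \<bar>\<mu>\<bar>\<close>.\<close>

lemma exp_radon_bounded:
  assumes f[measurable]: "f \<in> borel_measurable borel" and \<theta>: "norm \<theta> = 1"
    and B: "\<And>y. \<bar>f y\<bar> \<le> B" and supp: "\<And>y. y \<notin> cball 0 1 \<Longrightarrow> f y = 0"
  shows "\<bar>exp_radon \<mu> f \<theta> s\<bar> \<le> 2 * exp \<bar>\<mu>\<bar> * B"
proof -
  define F where "F t = exp (\<mu> * t) * f (s *\<^sub>R \<theta> + t *\<^sub>R perp \<theta>)" for t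
  have B0: "B \<ge> 0" using B[of 0] by linarith
  have le: "\<bar>F t\<bar> \<le> indicator {-1..1} t * (exp \<bar>\<mu>\<bar> * B)" for t
  proof (cases "\<bar>t\<bar> \<le> 1")
    case True
    have "\<mu> * t \<le> \<bar>\<mu>\<bar> * 1"
      using True by (metis abs_ge_self abs_ge_zero abs_mult mult_left_mono order.trans)
    then have "exp (\<mu> * t) * \<bar>f (s *\<^sub>R \<theta> + t *\<^sub>R perp \<theta>)\<bar> \<le> exp \<bar>\<mu>\<bar> * B"
      using B by (intro mult_mono) auto
    then show ?thesis using True by (simp add: F_def abs_mult abs_le_iff)
  next
    case False
    then have "\<not> norm (s *\<^sub>R \<theta> + t *\<^sub>R perp \<theta>) \<le> 1"
      using frame_coordinates(4)[OF \<theta>, of t s] by linarith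
    then have "f (s *\<^sub>R \<theta> + t *\<^sub>R perp \<theta>) = 0" by (intro supp) auto
    then show ?thesis using B0 by (simp add: F_def)
  qed
  have D: "integrable lborel (\<lambda>t::real. indicator {-1..1} t * (exp \<bar>\<mu>\<bar> * B))"
    by (intro integrable_mult_left) simp
  have Fi: "integrable lborel F"
  proof (rule Bochner_Integration.integrable_bound[OF D])
    show "F \<in> borel_measurable lborel" unfolding F_def by measurable
  qed (use le B0 in \<open>auto intro: order.trans[OF _ abs_ge_self]\<close>)
  have "(\<integral>t. \<bar>F t\<bar> \<partial>lborel) \<le> (\<integral>t. indicator {-1..1::real} t * (exp \<bar>\<mu>\<bar> * B) \<partial>lborel)"
    by (rule integral_mono[OF integrable_abs[OF Fi] D le])
  then have "\<bar>\<integral>t. F t \<partial>lborel\<bar> \<le> (\<integral>t. indicator {-1..1::real} t * (exp \<bar>\<mu>\<bar> * B) \<partial>lborel)"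
    by (rule order.trans[OF integral_abs_bound])
  also have "\<dots> = 2 * exp \<bar>\<mu>\<bar> * B" by simp
  finally show ?thesis unfolding exp_radon_unit[OF f \<theta>] F_def .
qed

text \<open>The coefficient of an observation in the estimator. Being a function of the design point
  alone, it is independent of the error it multiplies.\<close>

definition weight :: "real \<Rightarrow> real \<Rightarrow> real^2 \<Rightarrow> (real^2) \<times> real \<Rightarrow> real" where
  "weight \<mu> \<rho> x p = exp (- \<mu> * (x \<bullet> perp (fst p))) * radon_kernel \<mu> \<rho> (x \<bullet> fst p - snd p)"

lemma measurable_weight [measurable]: "weight \<mu> \<rho> x \<in> borel_measurable borel"
  unfolding weight_def borel_prod[symmetric] by measurable

lemma weight_bounded:
  obtains C where "\<And>\<phi> s. \<bar>weight \<mu> \<rho> x (dir \<phi>, s)\<bar> \<le> C"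
proof -
  obtain C where C: "\<And>t. \<bar>radon_kernel \<mu> \<rho> t\<bar> \<le> C" using bounded_radon_kernel by blast
  have "\<bar>weight \<mu> \<rho> x (dir \<phi>, s)\<bar> \<le> exp (\<bar>\<mu>\<bar> * norm x) * C" for \<phi> s
    using exp_inner_perp_le[of "dir \<phi>"] C unfolding weight_def
    by (simp only: abs_mult abs_exp_cancel fst_conv snd_conv) (intro mult_mono, auto)
  then show ?thesis using that by blast
qed

text \<open>The distribution lives on the unit circle in its first component. A bound is asked only
  there, since \<open>weight\<close> may grow exponentially away from the circle.\<close>

lemma integrable_uniform_Z_bounded:
  fixes h :: "(real^2) \<times> real \<Rightarrow> real"
  assumes h[measurable]: "h \<in> borel_measurable borel" and C: "\<And>\<phi> s. \<bar>h (dir \<phi>, s)\<bar> \<le> C"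
  shows "integrable uniform_Z h"
proof -
  have D: "integrable (arc_measure \<Otimes>\<^sub>M lborel) (\<lambda>(\<phi>, s::real). C * indicator {-1..1} s)"
    by (intro arc_lborel.integrable_times arc.integrable_const) simp
  have "integrable (arc_measure \<Otimes>\<^sub>M lborel) (\<lambda>p. indicator {-1..1} (snd p) * h (dir (fst p), snd p))"
  proof (rule Bochner_Integration.integrable_bound[OF D])
    show "AE p in arc_measure \<Otimes>\<^sub>M lborel. norm (indicator {-1..1} (snd p) * h (dir (fst p), snd p))
      \<le> norm (case p of (\<phi>, s) \<Rightarrow> C * indicator {-1..1} s)"
      using C by (intro AE_I2) (auto simp: case_prod_unfold indicator_def intro: order.trans[OF _ abs_ge_self])
  qed measurable
  then show ?thesis by (simp add: integrable_uniform_Z[OF h])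
qed

text \<open>Three interchanges of integrals lead here: offset and line position merge into a plane
  integral for each direction, the direction is then averaged first for each fixed y, and finally y
  is integrated inside \<xi>, which produces \<open>cos_transform\<close>.\<close>

lemma integral_uniform_Z_weight_exp_radon:
  fixes f :: "real^2 \<Rightarrow> real"
  assumes f: "integrable lborel f" and B: "\<And>y. \<bar>f y\<bar> \<le> B"
    and supp: "\<And>y. y \<notin> cball 0 1 \<Longrightarrow> f y = 0" and \<rho>: "\<rho> > 0" and \<mu>: "\<mu> \<noteq> 0"
  shows "integrable uniform_Z (\<lambda>p. weight \<mu> \<rho> x p * exp_radon \<mu> f (fst p) (snd p))" (is ?int)
    and "(\<integral>p. weight \<mu> \<rho> x p * exp_radon \<mu> f (fst p) (snd p) \<partial>uniform_Z)
       = (\<integral>\<xi>. indicator (ball 0 (1 / \<rho>)) \<xi> * cos_transform f x \<xi> \<partial>lborel) / (2 * pi)\<^sup>2" (is ?eq)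
proof -
  have fm[measurable]: "f \<in> borel_measurable borel" using f by auto
  obtain C where C: "\<And>\<phi> s. \<bar>weight \<mu> \<rho> x (dir \<phi>, s)\<bar> \<le> C" using weight_bounded by blast
  obtain K where K: "\<And>t. \<bar>radon_kernel \<mu> \<rho> t\<bar> \<le> K" using bounded_radon_kernel by blast
  have K0: "K \<ge> 0" using K[of 0] by linarith
  let ?h = "\<lambda>p. weight \<mu> \<rho> x p * exp_radon \<mu> f (fst p) (snd p)"
  have hm[measurable]: "?h \<in> borel_measurable borel" by measurable
  show int: ?int
  proof (rule integrable_uniform_Z_bounded[OF hm])
    show "\<bar>?h (dir \<phi>, s)\<bar> \<le> C * (2 * exp \<bar>\<mu>\<bar> * B)" for \<phi> s
      using C exp_radon_bounded[OF fm norm_dir B supp] unfolding abs_mult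
      by (intro mult_mono) (auto intro: order.trans[OF abs_ge_zero])
  qed
  define Q where "Q \<phi> y = exp (- \<mu> * ((x - y) \<bullet> perp (dir \<phi>))) * radon_kernel \<mu> \<rho> ((x - y) \<bullet> dir \<phi>) * f y" for \<phi> y
  \<comment> \<open>\<open>f\<close> vanishes off the unit ball, so only
    \<open>norm (x - y) \<le> norm x + 1\<close> matters for the exponential.\<close>
  have Qle: "\<bar>Q \<phi> y\<bar> \<le> exp (\<bar>\<mu>\<bar> * (norm x + 1)) * K * \<bar>f y\<bar>" for \<phi> y
  proof (cases "y \<in> cball 0 1")
    case True
    have "norm (x - y) \<le> norm x + 1"
      using True norm_triangle_ineq4[of x y] by simp
    then have "exp (\<bar>\<mu>\<bar> * norm (x - y)) \<le> exp (\<bar>\<mu>\<bar> * (norm x + 1))"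
      by (simp add: mult_left_mono)
    then have "exp (- \<mu> * ((x - y) \<bullet> perp (dir \<phi>))) \<le> exp (\<bar>\<mu>\<bar> * (norm x + 1))"
      using exp_inner_perp_le[of "dir \<phi>" \<mu> "x - y"] by simp
    then show ?thesis unfolding Q_def abs_mult abs_exp_cancel
      using K by (intro mult_right_mono mult_mono) auto
  next
    case False
    then show ?thesis by (simp add: Q_def supp)
  qed
  have Qle': "norm (Q \<phi> y) \<le> norm (exp (\<bar>\<mu>\<bar> * (norm x + 1)) * K * \<bar>f y\<bar>)" for \<phi> y
    using order.trans[OF Qle abs_ge_self] by simp
  have Qm[measurable]: "Q \<phi> \<in> borel_measurable borel" for \<phi> unfolding Q_def by measurable
  have fa: "integrable lborel (\<lambda>y. \<bar>f y\<bar>)" using f by (rule integrable_abs)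
  have Qi: "integrable lborel (Q \<phi>)" for \<phi>
  proof (rule Bochner_Integration.integrable_bound)
    show "integrable lborel (\<lambda>y. exp (\<bar>\<mu>\<bar> * (norm x + 1)) * K * \<bar>f y\<bar>)"
      using fa by (intro integrable_mult_right)
  qed (use Qle in \<open>auto intro: order.trans[OF _ abs_ge_self]\<close>)
  have QQ: "integrable (arc_measure \<Otimes>\<^sub>M lborel) (\<lambda>(\<phi>, y). Q \<phi> y)"
  proof (rule Bochner_Integration.integrable_bound)
    show "integrable (arc_measure \<Otimes>\<^sub>M lborel) (\<lambda>(\<phi>, y). exp (\<bar>\<mu>\<bar> * (norm x + 1)) * K * \<bar>f y\<bar>)"
      using fa by (intro arc_lborel.integrable_times arc.integrable_const)
    show "(\<lambda>(\<phi>, y). Q \<phi> y) \<in> borel_measurable (arc_measure \<Otimes>\<^sub>M lborel)"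
      unfolding Q_def by measurable
    show "AE p in arc_measure \<Otimes>\<^sub>M lborel. norm (case p of (\<phi>, y) \<Rightarrow> Q \<phi> y)
      \<le> norm (case p of (\<phi>, y) \<Rightarrow> exp (\<bar>\<mu>\<bar> * (norm x + 1)) * K * \<bar>f y\<bar>)"
      by (intro AE_I2) (simp only: case_prod_unfold Qle')
  qed
  \<comment> \<open>Restricting offsets to [-1, 1] loses nothing: any other line orthogonal to the
    direction misses the support of \<open>f\<close>. The remaining double integral in s and t is
    the plane integral in rotated coordinates.\<close>
  have slice: "(\<integral>s. indicator {-1..1} s * ?h (dir \<phi>, s) \<partial>lborel) = (\<integral>y. Q \<phi> y \<partial>lborel)" for \<phi>
  proof -
    let ?y = "\<lambda>s t. s *\<^sub>R dir \<phi> + t *\<^sub>R perp (dir \<phi>)"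
    note fc = frame_coordinates[OF norm_dir[of \<phi>]]
    \<comment> \<open>In the frame, \<open>(x - y) \<bullet> perp (dir \<phi>)\<close> is
      \<open>x \<bullet> perp (dir \<phi>) - t\<close>. The exponential therefore factors into the
      weight of the estimator and that of the transform.\<close>
    have Qy: "Q \<phi> (?y s t) = weight \<mu> \<rho> x (dir \<phi>, s) * (exp (\<mu> * t) * f (?y s t))" for s t
    proof -
      have "exp (- \<mu> * ((x - ?y s t) \<bullet> perp (dir \<phi>))) = exp (- \<mu> * (x \<bullet> perp (dir \<phi>))) * exp (\<mu> * t)"
        unfolding inner_diff_left fc by (simp add: exp_add[symmetric] algebra_simps)
      moreover have "(x - ?y s t) \<bullet> dir \<phi> = x \<bullet> dir \<phi> - s"
        unfolding inner_diff_left fc ..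
      ultimately show ?thesis by (simp add: Q_def weight_def)
    qed
    have z: "Q \<phi> (?y s t) = 0" if "s \<notin> {-1..1}" for s t
    proof -
      have "\<not> norm (?y s t) \<le> 1" using fc(3)[of s t] that by auto
      then show ?thesis by (simp add: Q_def supp)
    qed
    have "indicator {-1..1} s * ?h (dir \<phi>, s) = (\<integral>t. Q \<phi> (?y s t) \<partial>lborel)" for s
    proof (cases "s \<in> {-1..1}")
      case True
      then show ?thesis unfolding Qy by (simp add: exp_radon_unit[OF fm norm_dir])
    next
      case False
      then show ?thesis using z[OF False] by simp
    qed
    then have "(\<integral>s. indicator {-1..1} s * ?h (dir \<phi>, s) \<partial>lborel) = (\<integral>s. (\<integral>t. Q \<phi> (?y s t) \<partial>lborel) \<partial>lborel)"
      by (simp only:)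
    also have "\<dots> = (\<integral>p. Q \<phi> (?y (fst p) (snd p)) \<partial>(lborel \<Otimes>\<^sub>M lborel))"
    proof -
      have "integrable (lborel \<Otimes>\<^sub>M lborel) (\<lambda>p. Q \<phi> (?y (fst p) (snd p)))"
        using Qi[of \<phi>]
        by (subst (asm) lborel_real2_eq_distr_frame[OF norm_dir[of \<phi>], symmetric], subst (asm) integrable_distr_eq) auto
      from lborel_pair.integral_fst'[OF this] show ?thesis by simp
    qed
    also have "\<dots> = (\<integral>y. Q \<phi> y \<partial>lborel)"
    proof -
      have "(\<integral>y. Q \<phi> y \<partial>lborel) = (\<integral>y. Q \<phi> y \<partial>distr (lborel \<Otimes>\<^sub>M lborel) borel (\<lambda>p. ?y (fst p) (snd p)))"
        by (simp only: lborel_real2_eq_distr_frame[OF norm_dir])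
      also have "\<dots> = (\<integral>p. Q \<phi> (?y (fst p) (snd p)) \<partial>(lborel \<Otimes>\<^sub>M lborel))"
        by (rule integral_distr) auto
      finally show ?thesis ..
    qed
    finally show ?thesis .
  qed
  have "(\<integral>p. ?h p \<partial>uniform_Z)
     = 1 / (4 * pi) * (\<integral>p. indicator {-1..1} (snd p) * ?h (dir (fst p), snd p) \<partial>(arc_measure \<Otimes>\<^sub>M lborel))"
    by (rule integral_uniform_Z[OF hm])
  also have "(\<integral>p. indicator {-1..1} (snd p) * ?h (dir (fst p), snd p) \<partial>(arc_measure \<Otimes>\<^sub>M lborel))
     = (\<integral>\<phi>. (\<integral>s. indicator {-1..1} s * ?h (dir \<phi>, s) \<partial>lborel) \<partial>arc_measure)"
    using arc_lborel.integral_fst'[OF int[unfolded integrable_uniform_Z[OF hm]]] by simp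
  also have "\<dots> = (\<integral>\<phi>. (\<integral>y. Q \<phi> y \<partial>lborel) \<partial>arc_measure)"
    by (simp only: slice)
  also have "\<dots> = (\<integral>y. (\<integral>\<phi>. Q \<phi> y \<partial>arc_measure) \<partial>lborel)"
    by (rule arc_lborel.Fubini_integral[OF QQ, symmetric])
  also have "\<dots> = (\<integral>y. 1 / pi * (\<integral>\<xi>. f y * (indicator (ball 0 (1 / \<rho>)) \<xi> * cos (\<xi> \<bullet> (x - y))) \<partial>lborel) \<partial>lborel)"
  proof -
    have "(\<integral>\<phi>. Q \<phi> y \<partial>arc_measure) = 1 / pi * (\<integral>\<xi>. f y * (indicator (ball 0 (1 / \<rho>)) \<xi> * cos (\<xi> \<bullet> (x - y))) \<partial>lborel)" for y
      unfolding Q_def integral_mult_left_zero integral_mult_right_zero integral_arc_radon_kernel[OF \<rho> \<mu>]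
      by simp
    then show ?thesis by (simp only:)
  qed
  also have "\<dots> = 1 / pi * (\<integral>y. (\<integral>\<xi>. f y * (indicator (ball 0 (1 / \<rho>)) \<xi> * cos (\<xi> \<bullet> (x - y))) \<partial>lborel) \<partial>lborel)"
    by (rule integral_mult_right_zero)
  also have "(\<integral>y. (\<integral>\<xi>. f y * (indicator (ball 0 (1 / \<rho>)) \<xi> * cos (\<xi> \<bullet> (x - y))) \<partial>lborel) \<partial>lborel)
    = (\<integral>\<xi>. (\<integral>y. f y * (indicator (ball 0 (1 / \<rho>)) \<xi> * cos (\<xi> \<bullet> (x - y))) \<partial>lborel) \<partial>lborel)"
  \<comment> \<open>The truncation to a disc of finite area makes the product with the integrable
    \<open>f\<close> absolutely integrable.\<close>
  proof (rule lborel_pair.Fubini_integral)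
    have D: "integrable (lborel \<Otimes>\<^sub>M lborel) (\<lambda>(\<xi> :: real^2, y). indicator (ball 0 (1 / \<rho>)) \<xi> * f y)"
      using f by (intro lborel_pair.integrable_times) (auto intro!: integrable_real_indicator emeasure_bounded_finite)
    show "integrable (lborel \<Otimes>\<^sub>M lborel) (\<lambda>(\<xi>, y). f y * (indicator (ball 0 (1 / \<rho>)) \<xi> * cos (\<xi> \<bullet> (x - y))))"
    proof (rule Bochner_Integration.integrable_bound[OF D])
      have "\<bar>f y * (indicator (ball 0 (1 / \<rho>)) \<xi> * cos (\<xi> \<bullet> (x - y)))\<bar> \<le> \<bar>indicator (ball 0 (1 / \<rho>)) \<xi> * f y\<bar>" for \<xi> y
        using mult_left_le[of "\<bar>cos (\<xi> \<bullet> (x - y))\<bar>" "\<bar>f y\<bar>"] by (simp add: indicator_def abs_mult)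
      then show "AE p in lborel \<Otimes>\<^sub>M lborel. norm (case p of (\<xi>, y) \<Rightarrow> f y * (indicator (ball 0 (1 / \<rho>)) \<xi> * cos (\<xi> \<bullet> (x - y))))
        \<le> norm (case p of (\<xi>, y) \<Rightarrow> indicator (ball 0 (1 / \<rho>)) \<xi> * f y)"
        by (intro AE_I2) (simp add: case_prod_unfold)
      have [measurable]: "(ball 0 (1 / \<rho>) :: (real^2) set) \<in> sets borel" by simp
      show "(\<lambda>(\<xi>, y). f y * (indicator (ball 0 (1 / \<rho>)) \<xi> * cos (\<xi> \<bullet> (x - y)))) \<in> borel_measurable (lborel \<Otimes>\<^sub>M lborel)"
        by measurable
    qed
  qed
  also have "\<dots> = (\<integral>\<xi>. indicator (ball 0 (1 / \<rho>)) \<xi> * cos_transform f x \<xi> \<partial>lborel)"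
    unfolding cos_transform_def integral_mult_right_zero[symmetric] by (simp only: mult.left_commute)
  finally show ?eq
    by (simp add: power2_eq_square field_simps)
qed

section \<open>The bias of the estimator\<close>

lemma sobolev_class_properties:
  assumes f: "f \<in> sobolev_class \<beta> L"
  shows "continuous_on UNIV f" and "\<And>y. y \<notin> cball 0 1 \<Longrightarrow> f y = 0"
    and "integrable lborel f" and "\<exists>B. \<forall>y. \<bar>f y\<bar> \<le> B"
proof -
  show c: "continuous_on UNIV f" and s: "\<And>y. y \<notin> cball 0 1 \<Longrightarrow> f y = 0"
    using f by (auto simp: sobolev_class_def)
  have "integrable lborel (\<lambda>y. indicator (cball 0 1) y *\<^sub>R f y)"
    by (intro borel_integrable_compact continuous_on_subset[OF c]) auto
  moreover have "(\<lambda>y. indicator (cball 0 1) y *\<^sub>R f y) = f"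
    using s by (auto simp: indicator_def fun_eq_iff)
  ultimately show "integrable lborel f" by simp
  have "bounded (f ` cball 0 1)"
    by (intro compact_imp_bounded compact_continuous_image continuous_on_subset[OF c]) auto
  then obtain B where B: "\<forall>y\<in>cball 0 1. \<bar>f y\<bar> \<le> B"
    by (auto simp: bounded_iff)
  have "\<bar>f y\<bar> \<le> \<bar>B\<bar>" for y
    using B s[of y] by (cases "y \<in> cball 0 1") (auto intro: order.trans[OF _ abs_ge_self])
  then show "\<exists>B. \<forall>y. \<bar>f y\<bar> \<le> B" by blast
qed

theorem theorem2:
  fixes M :: "'w measure"
    and \<theta> :: "nat \<Rightarrow> 'w \<Rightarrow> real^2" and s \<epsilon> Y :: "nat \<Rightarrow> 'w \<Rightarrow> real"
    and f :: "real^2 \<Rightarrow> real" and \<beta> L \<mu> \<sigma> :: real and \<rho> :: "nat \<Rightarrow> real" and x :: "real^2"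
  assumes "\<beta> > 1" and "L > 0" and "f \<in> sobolev_class \<beta> L"
    and "prob_space M"
    and "prob_space.indep_vars M (\<lambda>_. borel) (\<lambda>i \<omega>. (\<theta> i \<omega>, s i \<omega>)) {1..}"
    and "\<And>i. i \<ge> 1 \<Longrightarrow> distr M borel (\<lambda>\<omega>. (\<theta> i \<omega>, s i \<omega>)) = uniform_Z"
    and "prob_space.indep_vars M (\<lambda>_. borel) \<epsilon> {1..}"
    and "\<And>i. i \<ge> 1 \<Longrightarrow> distr M borel (\<epsilon> i) = distr M borel (\<epsilon> 1)"
    and "\<And>i. i \<ge> 1 \<Longrightarrow> integrable M (\<epsilon> i)"
    and "\<And>i. i \<ge> 1 \<Longrightarrow> integrable M (\<lambda>\<omega>. (\<epsilon> i \<omega>)\<^sup>2)"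
    and "\<And>i. i \<ge> 1 \<Longrightarrow> prob_space.expectation M (\<epsilon> i) = 0"
    and "\<sigma> > 0" and "\<And>i. i \<ge> 1 \<Longrightarrow> prob_space.variance M (\<epsilon> i) = \<sigma>\<^sup>2"
    and "indep_rv M
           (\<Pi>\<^sub>M i\<in>{1..}. borel) (\<lambda>\<omega>. \<lambda>i\<in>{1..}. (\<theta> i \<omega>, s i \<omega>))
           (\<Pi>\<^sub>M i\<in>{1..}. borel) (\<lambda>\<omega>. \<lambda>i\<in>{1..}. \<epsilon> i \<omega>)"
    and "\<And>i \<omega>. i \<ge> 1 \<Longrightarrow> \<omega> \<in> space M \<Longrightarrow> Y i \<omega> = exp_radon \<mu> f (\<theta> i \<omega>) (s i \<omega>) + \<epsilon> i \<omega>"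
    and "\<And>n. n \<ge> 1 \<Longrightarrow> \<rho> n > 0"
    and "\<And>n. n \<ge> 1 \<Longrightarrow> 0 < \<bar>\<mu>\<bar> \<and> \<bar>\<mu>\<bar> < 1 / \<rho> n"
    and "\<rho> \<longlonglongrightarrow> 0"
    and "x \<in> cball 0 1"
  shows "(\<lambda>n. prob_space.expectation M
            (\<lambda>\<omega>. estimator \<mu> (\<rho> n) n (\<lambda>i. \<theta> i \<omega>) (\<lambda>i. s i \<omega>) (\<lambda>i. Y i \<omega>) x) - f x)
         \<longlonglongrightarrow> 0"
proof -
  interpret prob_space M by fact
  note cont = sobolev_class_properties(1)[OF assms(3)]
    and supp = sobolev_class_properties(2)[OF assms(3)]
    and fi = sobolev_class_properties(3)[OF assms(3)]
  obtain B where B: "\<And>y. \<bar>f y\<bar> \<le> B" using sobolev_class_properties(4)[OF assms(3)] by blast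
  have fm[measurable]: "f \<in> borel_measurable borel" using fi by auto
  have \<mu>: "\<mu> \<noteq> 0" using assms(17)[of 1] by auto
  \<comment> \<open>The common mean of all summands: it depends on n only through
    \<open>\<rho> n\<close>, and not on the index i, because the design points are identically
    distributed.\<close>
  define A where "A n = (\<integral>\<xi>. indicator (ball 0 (1 / \<rho> n)) \<xi> * cos_transform f x \<xi> \<partial>lborel) / (2 * pi)\<^sup>2" for n
  have term_eq: "integrable M (\<lambda>\<omega>. weight \<mu> (\<rho> n) x (\<theta> i \<omega>, s i \<omega>) * Y i \<omega>)
      \<and> expectation (\<lambda>\<omega>. weight \<mu> (\<rho> n) x (\<theta> i \<omega>, s i \<omega>) * Y i \<omega>) = A n"
    if i: "i \<ge> 1" and n: "n \<ge> 1" for i n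
  proof -
    let ?X = "\<lambda>\<omega>. (\<theta> i \<omega>, s i \<omega>)" and ?W = "weight \<mu> (\<rho> n) x"
    let ?h = "\<lambda>p. ?W p * exp_radon \<mu> f (fst p) (snd p)"
    have Xm[measurable]: "?X \<in> borel_measurable M"
      using assms(5) i by (auto simp: indep_vars_def)
    have hm[measurable]: "?h \<in> borel_measurable borel" by measurable
    note hZ = integral_uniform_Z_weight_exp_radon[OF fi B supp assms(16)[OF n] \<mu>, of x]
    have h: "integrable M (\<lambda>\<omega>. ?h (?X \<omega>))" "expectation (\<lambda>\<omega>. ?h (?X \<omega>)) = A n"
    proof -
      show "integrable M (\<lambda>\<omega>. ?h (?X \<omega>))"
        using hZ(1) integrable_distr_eq[OF Xm hm] unfolding assms(6)[OF i] by simp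
      show "expectation (\<lambda>\<omega>. ?h (?X \<omega>)) = A n"
        using hZ(2) integral_distr[OF Xm hm] unfolding assms(6)[OF i] A_def by simp
    qed
    obtain C where C: "\<And>\<phi> t. \<bar>?W (dir \<phi>, t)\<bar> \<le> C" using weight_bounded by blast
    have "integrable uniform_Z ?W"
      by (rule integrable_uniform_Z_bounded[where C=C]) (simp_all add: C)
    then have W: "integrable M (\<lambda>\<omega>. ?W (?X \<omega>))"
      using integrable_distr_eq[OF Xm measurable_weight] unfolding assms(6)[OF i] by simp
    \<comment> \<open>Independence is assumed between the two whole sequences; projecting both to
      coordinate i gives it for the single weight and error.\<close>
    have "indep_var borel (\<lambda>\<omega>. ?W ((\<lambda>i\<in>{1..}. (\<theta> i \<omega>, s i \<omega>)) i)) borel (\<lambda>\<omega>. (\<lambda>i\<in>{1..}. \<epsilon> i \<omega>) i)"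
    proof (rule indep_rv_imp_indep_var[OF assms(14)])
      have [measurable]: "(\<lambda>v. v i) \<in> (\<Pi>\<^sub>M i\<in>{1..}. borel :: ((real^2) \<times> real) measure) \<rightarrow>\<^sub>M borel"
        using i by (intro measurable_component_singleton) simp
      show "(\<lambda>v. ?W (v i)) \<in> (\<Pi>\<^sub>M i\<in>{1..}. borel) \<rightarrow>\<^sub>M borel" by measurable
      show "(\<lambda>v. v i) \<in> (\<Pi>\<^sub>M i\<in>{1..}. borel) \<rightarrow>\<^sub>M borel"
        using i by (intro measurable_component_singleton) simp
    qed
    then have ind: "indep_var borel (\<lambda>\<omega>. ?W (?X \<omega>)) borel (\<epsilon> i)" using i by simp
    \<comment> \<open>The weight and the error are both integrable, so independence makes their
      product integrable with mean the product of the means, which is 0.\<close>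
    note e = indep_var_integrable[OF ind W assms(9)[OF i]] indep_var_lebesgue_integral[OF ind W assms(9)[OF i]]
    have Yeq: "?W (?X \<omega>) * Y i \<omega> = ?h (?X \<omega>) + ?W (?X \<omega>) * \<epsilon> i \<omega>" if "\<omega> \<in> space M" for \<omega>
      using assms(15)[OF i that] by (simp add: distrib_left)
    have "integrable M (\<lambda>\<omega>. ?W (?X \<omega>) * Y i \<omega>) \<longleftrightarrow> integrable M (\<lambda>\<omega>. ?h (?X \<omega>) + ?W (?X \<omega>) * \<epsilon> i \<omega>)"
      by (rule Bochner_Integration.integrable_cong[OF refl Yeq])
    moreover have "expectation (\<lambda>\<omega>. ?W (?X \<omega>) * Y i \<omega>) = expectation (\<lambda>\<omega>. ?h (?X \<omega>) + ?W (?X \<omega>) * \<epsilon> i \<omega>)"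
      by (rule Bochner_Integration.integral_cong[OF refl Yeq])
    moreover have "expectation (\<lambda>\<omega>. ?h (?X \<omega>) + ?W (?X \<omega>) * \<epsilon> i \<omega>) = A n"
      using Bochner_Integration.integral_add[OF h(1) e(1)] h(2) e(2) assms(11)[OF i] by simp
    ultimately show ?thesis
      using Bochner_Integration.integrable_add[OF h(1) e(1)] by simp
  qed
  have exp_eq: "expectation (\<lambda>\<omega>. estimator \<mu> (\<rho> n) n (\<lambda>i. \<theta> i \<omega>) (\<lambda>i. s i \<omega>) (\<lambda>i. Y i \<omega>) x) = A n"
    if n: "n \<ge> 1" for n
  proof -
    have "expectation (\<lambda>\<omega>. estimator \<mu> (\<rho> n) n (\<lambda>i. \<theta> i \<omega>) (\<lambda>i. s i \<omega>) (\<lambda>i. Y i \<omega>) x)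
      = expectation (\<lambda>\<omega>. 1 / real n * (\<Sum>i=1..n. weight \<mu> (\<rho> n) x (\<theta> i \<omega>, s i \<omega>) * Y i \<omega>))"
      by (simp only: estimator_def weight_def fst_conv snd_conv)
    also have "\<dots> = 1 / real n * (\<Sum>i=1..n. expectation (\<lambda>\<omega>. weight \<mu> (\<rho> n) x (\<theta> i \<omega>, s i \<omega>) * Y i \<omega>))"
      unfolding integral_mult_right_zero using term_eq n
      by (subst Bochner_Integration.integral_sum) auto
    also have "\<dots> = 1 / real n * (\<Sum>i=1..n. A n)"
      using term_eq n by simp
    also have "\<dots> = A n" using n by simp
    finally show ?thesis .
  qed
  note inv = fourier_inversion_real2[OF cont fi B sobolev_class_integrable_fourier2[OF assms(3,1) fm], of x]
  have "(\<lambda>n. \<integral>\<xi>. indicator (ball 0 (1 / \<rho> n)) \<xi> * cos_transform f x \<xi> \<partial>lborel)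
      \<longlonglongrightarrow> (\<integral>\<xi>. cos_transform f x \<xi> \<partial>lborel)"
  proof (rule integral_dominated_convergence[where w="\<lambda>\<xi>. \<bar>cos_transform f x \<xi>\<bar>"])
    have "(\<lambda>n. indicator (ball 0 (1 / \<rho> n)) \<xi> * cos_transform f x \<xi>) \<longlonglongrightarrow> cos_transform f x \<xi>" for \<xi>
    proof (rule tendsto_eventually)
      \<comment> \<open>Adding 1 to the norm keeps the threshold positive and finite at \<xi> = 0 as
        well; below it, \<xi> lies in the open disc and the indicator equals 1 from then on.\<close>
      have "\<forall>\<^sub>F n in sequentially. \<rho> n < 1 / (norm \<xi> + 1)"
        using assms(18) by (rule order_tendstoD) (simp add: add_nonneg_pos)
      moreover have "\<forall>\<^sub>F n in sequentially. n \<ge> (1::nat)" by (rule eventually_ge_at_top)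
      ultimately show "\<forall>\<^sub>F n in sequentially. indicator (ball 0 (1 / \<rho> n)) \<xi> * cos_transform f x \<xi> = cos_transform f x \<xi>"
      proof eventually_elim
        case (elim n)
        have p: "norm \<xi> + 1 > 0" by (simp add: add_nonneg_pos)
        have "norm \<xi> + 1 < 1 / \<rho> n"
          using elim(1) assms(16)[OF elim(2)] p by (simp add: field_simps)
        then show ?case by simp
      qed
    qed
    then show "AE \<xi> in lborel. (\<lambda>n. indicator (ball 0 (1 / \<rho> n)) \<xi> * cos_transform f x \<xi>) \<longlonglongrightarrow> cos_transform f x \<xi>"
      by simp
    show "AE \<xi> in lborel. norm (indicator (ball 0 (1 / \<rho> n)) \<xi> * cos_transform f x \<xi>) \<le> \<bar>cos_transform f x \<xi>\<bar>" for n
      by (intro AE_I2) (simp add: indicator_def)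
    show "integrable lborel (\<lambda>\<xi>. \<bar>cos_transform f x \<xi>\<bar>)" using inv(1) by (rule integrable_abs)
    have [measurable]: "cos_transform f x \<in> borel_measurable borel" by (rule measurable_cos_transform) simp
    show "cos_transform f x \<in> borel_measurable lborel" by simp
    have [measurable]: "ball 0 (1 / \<rho> n) \<in> sets borel" for n by simp
    show "(\<lambda>\<xi>. indicator (ball 0 (1 / \<rho> n)) \<xi> * cos_transform f x \<xi>) \<in> borel_measurable lborel" for n
      by measurable
  qed
  then have "A \<longlonglongrightarrow> (2 * pi)\<^sup>2 * f x / (2 * pi)\<^sup>2"
    unfolding A_def inv(2) by (intro tendsto_divide tendsto_const) auto
  then have "(\<lambda>n. A n - f x) \<longlonglongrightarrow> 0"
    by (intro LIM_zero) simp
  \<comment> \<open>The equality is claimed from n = 1 on. At n = 0 the estimator is an empty sum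
    with the default value 0, and nothing is assumed about \<open>\<rho> 0\<close>.\<close>
  moreover have "\<forall>\<^sub>F n in sequentially. A n - f x
    = expectation (\<lambda>\<omega>. estimator \<mu> (\<rho> n) n (\<lambda>i. \<theta> i \<omega>) (\<lambda>i. s i \<omega>) (\<lambda>i. Y i \<omega>) x) - f x"
    using eventually_ge_at_top[of 1] by eventually_elim (simp add: exp_eq)
  ultimately show ?thesis
    by (rule Lim_transform_eventually)
qed

end
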